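(* Let $\lambda_1,\lambda_2\in(0,\infty)$, let $m=(m_1,m_2)\in\mathbb{R}^2$ be a unit vector and $D=\{x\in\mathbb{Z}^2: m\cdot x\geq 0\}$. If $(\log\lambda_1,\log\lambda_2)\neq-\|\log\vec\lambda\|(m_1,m_2)$, then $\gamma(H^D)>0$.
   Context: PVBS model on $\mathbb{Z}^2$ with parameters $\lambda_1,\lambda_2$: each site carries $\mathbb{C}^2$ with basis $|0\rangle,|1\rangle$; with $\phi^{(\lambda)}=(|01\rangle-\lambda|10\rangle)/\sqrt{1+\lambda^2}$ on the pair $(x,x+e_j)$ (first factor at $x$), $h_{x,x+e_j}=|\phi^{(\lambda_j)}\rangle\langle\phi^{(\lambda_j)}|+|11\rangle\langle11|$. $\log\vec\lambda=(\log\lambda_1,\log\lambda_2)$. $H^D$ is the Hamiltonian in the GNS representation of the all-$|0\rangle$ product state on $D$: its Hilbert space is the closure of the span of product vectors with finitely many sites of $D$ in $|1\rangle$, and $H^D$ is the self-adjoint closure of $\sum_{j}\sum_{x,x+e_j\in D}h_{x,x+e_j}$ on this span. For $H\geq0$ with $0\in\operatorname{spec}(H)$, $\gamma(H)=\sup\{\delta>0:\operatorname{spec}(H)\cap(0,\delta)=\emptyset\}$ (and $0$ if no such $\delta$). *)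

theory Defs
  imports "HOL-Analysis.Analysis"
begin

type_synonym site = "int \<times> int"
type_synonym config = "site set"   (* the set of sites in state |1> *)
type_synonym vec = "config \<Rightarrow> complex"

definition nb :: "site \<Rightarrow> nat \<Rightarrow> site" where
  "nb x j = (if j = 1 then (fst x + 1, snd x) else (fst x, snd x + 1))"

definition lam_of :: "real \<Rightarrow> real \<Rightarrow> nat \<Rightarrow> real" where
  "lam_of l1 l2 j = (if j = 1 then l1 else l2)"

definition half_plane :: "real \<Rightarrow> real \<Rightarrow> site set" where
  "half_plane m1 m2 = {x. m1 * real_of_int (fst x) + m2 * real_of_int (snd x) \<ge> 0}"

text \<open>Local two-site states (a_x, a_y), True meaning |1>.
  phi = (|01> - lam |10>)/sqrt(1+lam^2).\<close>
definition phi :: "real \<Rightarrow> bool \<times> bool \<Rightarrow> real" where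
  "phi lam a = (if a = (False, True) then 1 else if a = (True, False) then - lam else 0)
                / sqrt (1 + lam\<^sup>2)"

definition loc_h :: "real \<Rightarrow> bool \<times> bool \<Rightarrow> bool \<times> bool \<Rightarrow> real" where
  "loc_h lam a b = phi lam a * phi lam b
     + (if a = (True, True) \<and> b = (True, True) then 1 else 0)"

definition bond_elem :: "real \<Rightarrow> site \<Rightarrow> site \<Rightarrow> config \<Rightarrow> config \<Rightarrow> complex" where
  "bond_elem lam x y T S =
     (if T - {x, y} = S - {x, y}
      then complex_of_real (loc_h lam (x \<in> T, y \<in> T) (x \<in> S, y \<in> S)) else 0)"

text \<open>Matrix element <T| H |S> for finite S (bonds not touching S act as 0 on S).\<close>
definition Hmat :: "real \<Rightarrow> real \<Rightarrow> site set \<Rightarrow> config \<Rightarrow> config \<Rightarrow> complex" where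
  "Hmat l1 l2 D T S =
     (\<Sum>(x, j) \<in> {(x, j). j \<in> {1, 2} \<and> x \<in> D \<and> nb x j \<in> D \<and> (x \<in> S \<or> nb x j \<in> S)}.
        bond_elem (lam_of l1 l2 j) x (nb x j) T S)"

definition configs :: "site set \<Rightarrow> config set" where
  "configs D = {S. finite S \<and> S \<subseteq> D}"

definition l2norm :: "vec \<Rightarrow> real" where
  "l2norm \<psi> = sqrt (infsum (\<lambda>S. (cmod (\<psi> S))\<^sup>2) UNIV)"

text \<open>GNS Hilbert space of the all-|0> product state on D, as l^2 of finite configurations.\<close>
definition l2space :: "site set \<Rightarrow> vec set" where
  "l2space D = {\<psi>. (\<forall>S. S \<notin> configs D \<longrightarrow> \<psi> S = 0)
                   \<and> (\<lambda>S. (cmod (\<psi> S))\<^sup>2) summable_on UNIV}"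

definition core :: "site set \<Rightarrow> vec set" where
  "core D = {\<psi>. finite {S. \<psi> S \<noteq> 0} \<and> (\<forall>S. S \<notin> configs D \<longrightarrow> \<psi> S = 0)}"

definition Hcore :: "real \<Rightarrow> real \<Rightarrow> site set \<Rightarrow> vec \<Rightarrow> vec" where
  "Hcore l1 l2 D \<psi> = (\<lambda>T. \<Sum>S \<in> {S. \<psi> S \<noteq> 0}. Hmat l1 l2 D T S * \<psi> S)"

definition Hgraph :: "real \<Rightarrow> real \<Rightarrow> site set \<Rightarrow> (vec \<times> vec) set" where
  "Hgraph l1 l2 D = {(\<psi>, \<phi>). \<psi> \<in> l2space D \<and> \<phi> \<in> l2space D \<and>
      (\<exists>f. (\<forall>n. f n \<in> core D)
         \<and> (\<lambda>n. l2norm (\<lambda>S. f n S - \<psi> S)) \<longlonglongrightarrow> 0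
         \<and> (\<lambda>n. l2norm (\<lambda>S. Hcore l1 l2 D (f n) S - \<phi> S)) \<longlonglongrightarrow> 0)}"

definition op_spectrum :: "vec set \<Rightarrow> (vec \<times> vec) set \<Rightarrow> complex set" where
  "op_spectrum V G = - {z. (\<forall>\<phi>\<in>V. \<exists>!\<psi>. \<exists>w. (\<psi>, w) \<in> G \<and> (\<lambda>S. w S - z * \<psi> S) = \<phi>)
                        \<and> (\<exists>C. \<forall>(\<psi>, w) \<in> G. l2norm \<psi> \<le> C * l2norm (\<lambda>S. w S - z * \<psi> S))}"

definition gap_set :: "complex set \<Rightarrow> real set" where
  "gap_set sp = {\<delta>. \<delta> > 0 \<and> (\<forall>t. 0 < t \<and> t < \<delta> \<longrightarrow> complex_of_real t \<notin> sp)}"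

definition spectral_gap :: "complex set \<Rightarrow> ereal" where
  "spectral_gap sp = (if gap_set sp = {} then 0 else Sup (ereal ` gap_set sp))"

end

theory Submission
  imports Defs
begin

text \<open>On a single bond, the occupation numbers satisfy the operator inequality
  \<open>n_x \<le> (1 + \<epsilon>) \<lambda>\<^sup>-\<^sup>2 n_y + C h\<close> for \<open>y = x + e_j\<close>, and the same with \<open>x, y\<close> exchanged and \<open>\<lambda>\<close>
  inverted.  Unless \<open>log \<lambda>\<close> points along \<open>- m\<close>, there is an integer vector \<open>v\<close> with \<open>m \<bullet> v \<ge> 0\<close> and
  \<open>log \<lambda> \<bullet> v > 0\<close>.  Chaining the bond inequality along an L-shaped path from \<open>x\<close> to \<open>x + v\<close> inside
  the half-plane and summing over \<open>x\<close> gives \<open>N \<le> q N + C H\<close> with \<open>q < 1\<close> for the total particle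
  number \<open>N\<close>, so \<open>H \<ge> \<delta> N \<ge> \<delta>\<close> off the vacuum.
  Since \<open>H\<close> preserves \<open>N\<close> and \<open>H \<le> 4 N\<close>, it is bounded for bounded particle number; for \<open>0 < t < \<delta>\<close>
  a Richardson iteration then shows that \<open>H - t\<close> has dense range on the core.\<close>

section \<open>The bond inequality\<close>

text \<open>The bond term vanishes on one particle exactly when the amplitude changes by the factor
  \<lambda> from x to y, so occupation ought to change by \<lambda>^2. The bond inequality is the
  stable form of this. Its loss 1 + \<epsilon> cannot be zero, because a cross term has to be
  absorbed, and it is paid once per bond of the path. Hence v and the path length are fixed before
  \<epsilon>, which is then chosen so that the whole loss consumes only half of the gain 2 log
  \<lambda> \<bullet> v in the exponent. In the excluded case every v with log \<lambda> \<bullet> v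
  > 0 has m \<bullet> v < 0, so no such translation keeps the half-plane inside itself. The second
  obstacle is that a lower bound for H - t on the core gives injectivity but not surjectivity. The
  rate of the iteration depends on the particle number, which is harmless: each target in the core
  has bounded particle number, only density of the range is needed, and the lower bound on the
  closure then makes the range everything.\<close>

definition supp :: "vec \<Rightarrow> config set" where
  "supp f = {S. f S \<noteq> 0}"

text \<open>The quadratic form of one bond term. Taking real parts makes it real-valued by
  construction and loses nothing, since the matrix is real and symmetric.\<close>

definition bform :: "real \<Rightarrow> site \<Rightarrow> site \<Rightarrow> vec \<Rightarrow> real" where
  "bform lam x y f = (\<Sum>T\<in>supp f. \<Sum>S\<in>supp f. Re (cnj (f T) * (bond_elem lam x y T S * f S)))"

text \<open>The unnormalised expectation of the occupation number at x in the vector f.\<close>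

definition occ :: "vec \<Rightarrow> site \<Rightarrow> real" where
  "occ f x = (\<Sum>S\<in>supp f. if x \<in> S then (cmod (f S))\<^sup>2 else 0)"

definition fin_supp :: "vec \<Rightarrow> bool" where
  "fin_supp f \<longleftrightarrow> finite (supp f) \<and> (\<forall>S\<in>supp f. finite S)"

lemma loc_h_sym: "loc_h lam a b = loc_h lam b a"
  by (simp add: loc_h_def conj_commute mult.commute)

lemma loc_h_simps:
  "loc_h lam (True, True) b = (if b = (True, True) then 1 else 0)"
  "loc_h lam (False, False) b = 0"
  "loc_h lam (True, False) (True, False) = lam\<^sup>2 / (1 + lam\<^sup>2)"
  "loc_h lam (True, False) (False, True) = - lam / (1 + lam\<^sup>2)"
  "loc_h lam (False, True) (True, False) = - lam / (1 + lam\<^sup>2)"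
  "loc_h lam (False, True) (False, True) = 1 / (1 + lam\<^sup>2)"
  "loc_h lam (True, False) (False, False) = 0"
  "loc_h lam (True, False) (True, True) = 0"
  "loc_h lam (False, True) (False, False) = 0"
  "loc_h lam (False, True) (True, True) = 0"
proof -
  have "1 + lam\<^sup>2 \<ge> 0"
    by simp
  note r = real_sqrt_mult_self[of "1 + lam\<^sup>2"] abs_of_nonneg[OF this]
  show "loc_h lam (True, True) b = (if b = (True, True) then 1 else 0)"
    "loc_h lam (False, False) b = 0"
    "loc_h lam (True, False) (True, False) = lam\<^sup>2 / (1 + lam\<^sup>2)"
    "loc_h lam (True, False) (False, True) = - lam / (1 + lam\<^sup>2)"
    "loc_h lam (False, True) (True, False) = - lam / (1 + lam\<^sup>2)"
    "loc_h lam (False, True) (False, True) = 1 / (1 + lam\<^sup>2)"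
    "loc_h lam (True, False) (False, False) = 0"
    "loc_h lam (True, False) (True, True) = 0"
    "loc_h lam (False, True) (False, False) = 0"
    "loc_h lam (False, True) (True, True) = 0"
    using r by (simp_all add: loc_h_def phi_def power2_eq_square)
qed

lemma bond_elem_sym: "bond_elem lam x y T S = bond_elem lam x y S T"
  by (simp add: bond_elem_def eq_commute loc_h_sym[of lam "(x \<in> T, y \<in> T)"])

lemma bond_elem_outside:
  assumes "x \<notin> S" "y \<notin> S"
  shows "bond_elem lam x y T S = 0"
  using assms by (simp add: bond_elem_def loc_h_def phi_def)

lemma bond_elem_nonzero:
  assumes "bond_elem lam x y T S \<noteq> 0" "x \<noteq> y"
  shows "T - {x, y} = S - {x, y}"
    and "(x \<in> T \<and> y \<in> T \<and> x \<in> S \<and> y \<in> S) \<or> ((x \<in> T) \<noteq> (y \<in> T) \<and> (x \<in> S) \<noteq> (y \<in> S))"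
  using assms by (auto simp: bond_elem_def loc_h_def phi_def split: if_splits)

lemma bond_elem_subset:
  assumes "bond_elem lam x y T S \<noteq> 0"
  shows "T \<subseteq> S \<union> {x, y}"
  using assms by (auto simp: bond_elem_def split: if_splits)

text \<open>Off the bond both configurations agree, and on it the local matrix links |11> only to
  itself and |01>, |10> only to each other. This is the source of particle number
  conservation.\<close>

lemma bond_elem_card:
  assumes nz: "bond_elem lam x y T S \<noteq> 0" and xy: "x \<noteq> y" and "finite S"
  shows "card T = card S"
proof -
  have fT: "finite T"
    using bond_elem_subset[OF nz] \<open>finite S\<close> by (meson finite.emptyI finite.insertI finite_UnI finite_subset)
  have split: "card U = card (U - {x, y}) + card (U \<inter> {x, y})" if "finite U" for U :: config
    using card_Int_Diff[OF that, of "{x, y}"] by simp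
  have "card (T \<inter> {x, y}) = card (S \<inter> {x, y})"
    using bond_elem_nonzero(2)[OF nz xy] xy by (auto simp: Int_insert_right)
  then show ?thesis
    using split[OF fT] split[OF \<open>finite S\<close>] bond_elem_nonzero(1)[OF nz xy] by simp
qed

lemma sum_Pow_insert:
  fixes F :: "'a set \<Rightarrow> 'b::comm_monoid_add"
  assumes "finite A" "x \<notin> A"
  shows "sum F (Pow (insert x A)) = (\<Sum>R\<in>Pow A. F R + F (insert x R))"
proof -
  have inj: "inj_on (insert x) (Pow A)"
    using assms(2) by (auto simp: inj_on_def)
  have disj: "Pow A \<inter> insert x ` Pow A = {}"
    using assms(2) by auto
  have "sum F (Pow (insert x A)) = sum F (Pow A) + sum F (insert x ` Pow A)"
    unfolding Pow_insert by (rule sum.union_disjoint) (use assms disj in auto)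
  also have "sum F (insert x ` Pow A) = (\<Sum>R\<in>Pow A. F (insert x R))"
    using sum.reindex[OF inj] by simp
  finally show ?thesis
    by (simp add: sum.distrib)
qed

text \<open>Configurations are sorted by their restriction R to the sites off a bond; every R
  carries a block of four local states. All bond estimates are made block by block.\<close>

lemma sum_Pow_insert2:
  fixes F :: "'a set \<Rightarrow> 'b::comm_monoid_add"
  assumes "finite A" "x \<notin> A" "y \<notin> A" "x \<noteq> y"
  shows "sum F (Pow (insert x (insert y A))) =
    (\<Sum>R\<in>Pow A. F R + F (insert y R) + F (insert x R) + F (insert x (insert y R)))"
proof -
  have "sum F (Pow (insert x (insert y A))) = (\<Sum>R\<in>Pow (insert y A). F R + F (insert x R))"
    by (rule sum_Pow_insert) (use assms in auto)
  also have "\<dots> = (\<Sum>R\<in>Pow A. F R + F (insert x R) + (F (insert y R) + F (insert x (insert y R))))"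
    by (rule sum_Pow_insert) (use assms in auto)
  finally show ?thesis
    by (simp add: ac_simps)
qed

text \<open>Only the four configurations that agree with T off the bond can have a nonzero matrix
  element with T. On them the bond term is the projection onto the vector \<phi> plus the projection
  onto |11>; the first three branches are its components on |11>, |01> and |10>.\<close>

lemma bond_action:
  fixes f :: vec
  assumes A: "finite A" "x \<notin> A" "y \<notin> A" and xy: "x \<noteq> y" and T: "T - {x, y} \<subseteq> A"
  defines "R \<equiv> T - {x, y}"
  shows "(\<Sum>S\<in>Pow (insert x (insert y A)). bond_elem lam x y T S * f S) =
    (if x \<in> T \<and> y \<in> T then f (insert x (insert y R))
     else if y \<in> T then (f (insert y R) - lam * f (insert x R)) / (1 + lam\<^sup>2)
     else if x \<in> T then - lam * (f (insert y R) - lam * f (insert x R)) / (1 + lam\<^sup>2)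
     else 0)"
proof -
  let ?G = "\<lambda>S. bond_elem lam x y T S * f S"
  have "(\<Sum>S\<in>Pow (insert x (insert y A)). ?G S)
      = (\<Sum>Q\<in>Pow A. ?G Q + ?G (insert y Q) + ?G (insert x Q) + ?G (insert x (insert y Q)))"
    by (rule sum_Pow_insert2) (use A xy in auto)
  also have "\<dots> = (\<Sum>Q\<in>Pow A. if Q = R then ?G R + ?G (insert y R) + ?G (insert x R) + ?G (insert x (insert y R)) else 0)"
  proof (rule sum.cong)
    fix Q assume Q: "Q \<in> Pow A"
    then have d: "Q - {x,y} = Q" "insert y Q - {x,y} = Q" "insert x Q - {x,y} = Q"
        "insert x (insert y Q) - {x,y} = Q"
      using A by auto
    show "?G Q + ?G (insert y Q) + ?G (insert x Q) + ?G (insert x (insert y Q)) =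
       (if Q = R then ?G R + ?G (insert y R) + ?G (insert x R) + ?G (insert x (insert y R)) else 0)"
    proof (cases "Q = R")
      case False
      then have "bond_elem lam x y T S = 0" if "S - {x,y} = Q" for S
        using that by (auto simp: bond_elem_def R_def)
      then show ?thesis
        using False d by simp
    qed simp
  qed simp
  also have "\<dots> = ?G R + ?G (insert y R) + ?G (insert x R) + ?G (insert x (insert y R))"
    using A(1) T by (simp add: R_def)
  also have "\<dots> = (if x \<in> T \<and> y \<in> T then f (insert x (insert y R))
     else if y \<in> T then (f (insert y R) - lam * f (insert x R)) / (1 + lam\<^sup>2)
     else if x \<in> T then - lam * (f (insert y R) - lam * f (insert x R)) / (1 + lam\<^sup>2)
     else 0)"
  proof -
    have d: "R - {x,y} = T - {x,y}" "insert y R - {x,y} = T - {x,y}" "insert x R - {x,y} = T - {x,y}"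
        "insert x (insert y R) - {x,y} = T - {x,y}"
      by (auto simp: R_def)
    have n: "x \<notin> R" "y \<notin> R"
      by (auto simp: R_def)
    show ?thesis
      unfolding bond_elem_def d
      using n xy
      by (cases "x \<in> T"; cases "y \<in> T")
         (simp_all add: loc_h_simps diff_divide_distrib right_diff_distrib power2_eq_square)
  qed
  finally show ?thesis by simp
qed

text \<open>In each block the form is the squared component along \<phi> plus the weight of |11>.
  Positivity, the upper bound by occupations and the occupation comparison are all read off this sum
  of squares.\<close>

lemma bform_eq:
  assumes A: "finite A" "x \<notin> A" "y \<notin> A" and xy: "x \<noteq> y"
    and sup: "supp f \<subseteq> Pow (insert x (insert y A))"
  shows "bform lam x y f = (\<Sum>R\<in>Pow A.
     (cmod (f (insert y R) - lam * f (insert x R)))\<^sup>2 / (1 + lam\<^sup>2) + (cmod (f (insert x (insert y R))))\<^sup>2)"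
proof -
  let ?K = "Pow (insert x (insert y A))"
  let ?g = "\<lambda>T. \<Sum>S\<in>?K. bond_elem lam x y T S * f S"
  have fK: "finite ?K" using A(1) by simp
  have z: "f S = 0" if "S \<notin> supp f" for S
    using that by (simp add: supp_def)
  have inner: "(\<Sum>S\<in>supp f. Re (cnj (f T) * (bond_elem lam x y T S * f S))) = Re (cnj (f T) * ?g T)" for T
  proof -
    have "(\<Sum>S\<in>supp f. Re (cnj (f T) * (bond_elem lam x y T S * f S)))
        = (\<Sum>S\<in>?K. Re (cnj (f T) * (bond_elem lam x y T S * f S)))"
      by (rule sum.mono_neutral_left) (use fK sup z in auto)
    then show ?thesis by (simp add: sum_distrib_left)
  qed
  have "bform lam x y f = (\<Sum>T\<in>supp f. Re (cnj (f T) * ?g T))"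
    unfolding bform_def inner ..
  also have "\<dots> = (\<Sum>T\<in>?K. Re (cnj (f T) * ?g T))"
    by (rule sum.mono_neutral_left) (use fK sup z in auto)
  also have "\<dots> = (\<Sum>R\<in>Pow A. Re (cnj (f R) * ?g R) + Re (cnj (f (insert y R)) * ?g (insert y R))
      + Re (cnj (f (insert x R)) * ?g (insert x R))
      + Re (cnj (f (insert x (insert y R))) * ?g (insert x (insert y R))))"
    by (rule sum_Pow_insert2) (use A xy in auto)
  also have "\<dots> = (\<Sum>R\<in>Pow A.
     (cmod (f (insert y R) - lam * f (insert x R)))\<^sup>2 / (1 + lam\<^sup>2) + (cmod (f (insert x (insert y R))))\<^sup>2)"
  proof (rule sum.cong)
    fix R assume "R \<in> Pow A"
    then have R: "R \<subseteq> A" "x \<notin> R" "y \<notin> R" using A by auto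
    have d: "R - {x,y} = R" "insert y R - {x,y} = R" "insert x R - {x,y} = R"
        "insert x (insert y R) - {x,y} = R" using R by auto
    note act = bond_action[OF A xy, where f = f and lam = lam]
    define a b where "a = f (insert x R)" and "b = f (insert y R)"
    have g0: "?g R = 0"
      using act[of R] d R xy by simp
    have gy: "?g (insert y R) = (b - lam * a) / (1 + lam\<^sup>2)"
      using act[of "insert y R"] d R xy unfolding a_def b_def by simp
    have gx: "?g (insert x R) = - lam * (b - lam * a) / (1 + lam\<^sup>2)"
      using act[of "insert x R"] d R xy unfolding a_def b_def by simp
    have gxy: "?g (insert x (insert y R)) = f (insert x (insert y R))"
      using act[of "insert x (insert y R)"] d R xy by simp
    have 1: "Re (cnj b * ((b - lam * a) / (1 + lam\<^sup>2))) + Re (cnj a * (- lam * (b - lam * a) / (1 + lam\<^sup>2)))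
       = (cmod (b - lam * a))\<^sup>2 / (1 + lam\<^sup>2)"
    proof -
      have "cnj b * ((b - lam * a) / (1 + lam\<^sup>2)) + cnj a * (- lam * (b - lam * a) / (1 + lam\<^sup>2))
         = cnj (b - lam * a) * (b - lam * a) / (1 + lam\<^sup>2)"
        by (simp add: algebra_simps add_divide_distrib diff_divide_distrib)
      also have "\<dots> = of_real ((cmod (b - lam * a))\<^sup>2 / (1 + lam\<^sup>2))"
        by (metis complex_norm_square mult.commute of_real_1 of_real_add of_real_divide of_real_power)
      finally show ?thesis
        by (metis Re_complex_of_real plus_complex.sel(1))
    qed
    have 2: "Re (cnj c * c) = (cmod c)\<^sup>2" for c
      by (metis Re_complex_of_real complex_norm_square mult.commute)
    show "Re (cnj (f R) * ?g R) + Re (cnj (f (insert y R)) * ?g (insert y R))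
      + Re (cnj (f (insert x R)) * ?g (insert x R))
      + Re (cnj (f (insert x (insert y R))) * ?g (insert x (insert y R)))
     = (cmod (f (insert y R) - lam * f (insert x R)))\<^sup>2 / (1 + lam\<^sup>2) + (cmod (f (insert x (insert y R))))\<^sup>2"
      unfolding g0 gy gx gxy unfolding a_def[symmetric] b_def[symmetric] using 1 2 by simp
  qed simp
  finally show ?thesis .
qed

lemma occ_eq:
  assumes "finite K" "supp f \<subseteq> K"
  shows "occ f z = (\<Sum>S\<in>K. if z \<in> S then (cmod (f S))\<^sup>2 else 0)"
  unfolding occ_def by (rule sum.mono_neutral_left) (use assms in \<open>auto simp: supp_def\<close>)

lemma occ_pair:
  assumes A: "finite A" "x \<notin> A" "y \<notin> A" and xy: "x \<noteq> y"
    and sup: "supp f \<subseteq> Pow (insert x (insert y A))"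
  shows "occ f x = (\<Sum>R\<in>Pow A. (cmod (f (insert x R)))\<^sup>2 + (cmod (f (insert x (insert y R))))\<^sup>2)"
    and "occ f y = (\<Sum>R\<in>Pow A. (cmod (f (insert y R)))\<^sup>2 + (cmod (f (insert x (insert y R))))\<^sup>2)"
proof -
  have fK: "finite (Pow (insert x (insert y A)))" using A by simp
  show "occ f x = (\<Sum>R\<in>Pow A. (cmod (f (insert x R)))\<^sup>2 + (cmod (f (insert x (insert y R))))\<^sup>2)"
    unfolding occ_eq[OF fK sup] sum_Pow_insert2[OF A xy]
    by (rule sum.cong) (use A xy in auto)
  show "occ f y = (\<Sum>R\<in>Pow A. (cmod (f (insert y R)))\<^sup>2 + (cmod (f (insert x (insert y R))))\<^sup>2)"
    unfolding occ_eq[OF fK sup] sum_Pow_insert2[OF A xy]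
    by (rule sum.cong) (use A xy in auto)
qed

lemma fin_supp_Pow:
  assumes "fin_supp f"
  obtains A where "finite A" "x \<notin> A" "y \<notin> A" "supp f \<subseteq> Pow (insert x (insert y A))"
proof
  show "finite (\<Union>(supp f) - {x, y})"
    using assms by (auto simp: fin_supp_def)
qed auto

lemma occ_nonneg: "occ f x \<ge> 0"
  unfolding occ_def by (rule sum_nonneg) simp

lemma bform_nonneg:
  assumes "fin_supp f" "x \<noteq> y"
  shows "bform lam x y f \<ge> 0"
proof -
  obtain A where A: "finite A" "x \<notin> A" "y \<notin> A" "supp f \<subseteq> Pow (insert x (insert y A))"
    using fin_supp_Pow[OF assms(1)] .
  show ?thesis
    unfolding bform_eq[OF A(1-3) assms(2) A(4)]
    by (intro sum_nonneg add_nonneg_nonneg divide_nonneg_nonneg) auto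
qed

text \<open>Cauchy-Schwarz in each block: the component along a unit vector is at most the norm. The
  weight of |11> enters once on the left and twice on the right.\<close>

lemma bform_le_occ:
  assumes "fin_supp f" "x \<noteq> y"
  shows "bform lam x y f \<le> occ f x + occ f y"
proof -
  obtain A where A: "finite A" "x \<notin> A" "y \<notin> A" "supp f \<subseteq> Pow (insert x (insert y A))"
    using fin_supp_Pow[OF assms(1)] .
  have le: "(cmod (b - lam * a))\<^sup>2 / (1 + lam\<^sup>2) \<le> (cmod a)\<^sup>2 + (cmod b)\<^sup>2" for a b :: complex
  proof -
    have "cmod (b - lam * a) \<le> cmod b + \<bar>lam\<bar> * cmod a"
      by (metis norm_mult norm_of_real norm_triangle_ineq4)
    then have "(cmod (b - lam * a))\<^sup>2 \<le> (cmod b + \<bar>lam\<bar> * cmod a)\<^sup>2"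
      by (rule power_mono) simp
    also have "\<dots> \<le> ((cmod a)\<^sup>2 + (cmod b)\<^sup>2) * (1 + lam\<^sup>2)"
    proof -
      have "((cmod a)\<^sup>2 + (cmod b)\<^sup>2) * (1 + lam\<^sup>2) - (cmod b + \<bar>lam\<bar> * cmod a)\<^sup>2
         = (cmod a - \<bar>lam\<bar> * cmod b)\<^sup>2"
        by (simp add: algebra_simps power2_eq_square)
      then show ?thesis by (smt (verit) zero_le_power2)
    qed
    finally show ?thesis
      by (subst pos_divide_le_eq) (simp_all add: add_pos_nonneg)
  qed
  show ?thesis
    unfolding bform_eq[OF A(1-3) assms(2) A(4)] occ_pair[OF A(1-3) assms(2) A(4)] sum.distrib[symmetric]
    by (rule sum_mono) (use le in \<open>smt (verit) zero_le_power2\<close>)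
qed

text \<open>Triangle inequality followed by Young's inequality with weight \<epsilon>; the defect of
  the latter is the square (\<epsilon> s - t)^2 / \<epsilon>.\<close>

lemma norm_sq_split:
  fixes p q :: "'a::real_normed_vector"
  assumes "\<epsilon> > 0"
  shows "(norm p)\<^sup>2 \<le> (1 + \<epsilon>) * (norm q)\<^sup>2 + (1 + 1 / \<epsilon>) * (norm (p - q))\<^sup>2"
proof -
  define s t where "s = norm q" and "t = norm (p - q)"
  have "norm p \<le> s + t"
    unfolding s_def t_def by (metis add.commute norm_triangle_sub)
  then have "(norm p)\<^sup>2 \<le> (s + t)\<^sup>2"
    by (rule power_mono) simp
  moreover have "(1 + \<epsilon>) * s\<^sup>2 + (1 + 1 / \<epsilon>) * t\<^sup>2 - (s + t)\<^sup>2 = (\<epsilon> * s - t)\<^sup>2 / \<epsilon>"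
    using assms by (simp add: field_simps power2_eq_square)
  moreover have "(\<epsilon> * s - t)\<^sup>2 / \<epsilon> \<ge> 0"
    using assms by simp
  ultimately show ?thesis
    unfolding s_def t_def by linarith
qed

text \<open>Let a and b be the amplitudes with the single particle at x and at y. The energy
  controls b - \<lambda> a, so |b|^2 and \<lambda>^2 |a|^2 are comparable up to a factor close to 1.
  Writing the factors as exponentials makes them add up along a path; C is uniform in f, x and
  y.\<close>

lemma occ_step:
  assumes "lam > 0" "\<eta> > 0"
  obtains C where "C \<ge> 0"
    and "\<And>f x y. fin_supp f \<Longrightarrow> x \<noteq> y \<Longrightarrow>
       occ f x \<le> exp (\<eta> - 2 * ln lam) * occ f y + C * bform lam x y f"
    and "\<And>f x y. fin_supp f \<Longrightarrow> x \<noteq> y \<Longrightarrow>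
       occ f y \<le> exp (\<eta> + 2 * ln lam) * occ f x + C * bform lam x y f"
proof
  \<comment> \<open>Chosen so that the loss 1 + \<epsilon> is exactly the factor exp \<eta>.\<close>
  define \<epsilon> where "\<epsilon> = exp \<eta> - 1"
  have eps: "\<epsilon> > 0" using assms by (simp add: \<epsilon>_def)
  have expeta: "exp \<eta> = 1 + \<epsilon>" by (simp add: \<epsilon>_def)
  have exl: "exp (2 * ln lam) = lam\<^sup>2"
    using assms by (simp add: exp_double)
  have e1: "exp (\<eta> - 2 * ln lam) = (1 + \<epsilon>) / lam\<^sup>2"
    by (simp add: exp_diff exl expeta)
  have e2: "exp (\<eta> + 2 * ln lam) = (1 + \<epsilon>) * lam\<^sup>2"
    by (simp add: exp_add exl expeta)
  \<comment> \<open>The Young constant times 1 + \<lambda>^2, the normalisation of \<phi>, so that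
    \<open>k\<close> multiplies the energy of the block. In \<open>C\<close>, the summand 1 pays for
    |11>, \<open>k\<close> serves the bound on y, and \<open>k / lam\<^sup>2\<close> the bound on x,
    where the inequality is divided by \<lambda>^2.\<close>
  define k where "k = (1 + 1 / \<epsilon>) * (1 + lam\<^sup>2)"
  define C where "C = 1 + k + k / lam\<^sup>2"
  have k0: "k \<ge> 0" using eps by (simp add: k_def)
  have k1: "k / lam\<^sup>2 \<ge> 0" using k0 by simp
  show C0: "C \<ge> 0" using k0 k1 by (simp add: C_def)
  have cs: "(1 + 1 / \<epsilon>) * w = k * (w / (1 + lam\<^sup>2))" for w :: real
  proof -
    have "1 + lam\<^sup>2 \<noteq> 0"
      using assms(1) by (simp add: add_pos_pos order_less_imp_not_eq2)
    then show ?thesis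
      by (simp add: k_def)
  qed
  fix f x y assume f: "fin_supp f" and xy: "(x::site) \<noteq> y"
  obtain A where A: "finite A" "x \<notin> A" "y \<notin> A" "supp f \<subseteq> Pow (insert x (insert y A))"
    using fin_supp_Pow[OF f] .
  note eqs = bform_eq[OF A(1-3) xy A(4)] occ_pair[OF A(1-3) xy A(4)]
  have key1: "(cmod a)\<^sup>2 + d \<le> (1 + \<epsilon>) / lam\<^sup>2 * ((cmod b)\<^sup>2 + d) + C * ((cmod (b - lam * a))\<^sup>2 / (1 + lam\<^sup>2) + d)"
    if "d \<ge> 0" for a b :: complex and d :: real
  proof -
    define w where "w = (cmod (b - lam * a))\<^sup>2 / (1 + lam\<^sup>2)"
    have w0: "w \<ge> 0" by (simp add: w_def)
    have "(cmod (lam * a))\<^sup>2 \<le> (1 + \<epsilon>) * (cmod b)\<^sup>2 + (1 + 1 / \<epsilon>) * (cmod (b - lam * a))\<^sup>2"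
      using norm_sq_split[OF eps, of "lam * a" b] by (simp add: norm_minus_commute)
    then have "lam\<^sup>2 * (cmod a)\<^sup>2 \<le> (1 + \<epsilon>) * (cmod b)\<^sup>2 + k * w"
      by (simp add: norm_mult power_mult_distrib cs w_def)
    then have "(cmod a)\<^sup>2 \<le> (1 + \<epsilon>) / lam\<^sup>2 * (cmod b)\<^sup>2 + k / lam\<^sup>2 * w"
      using assms by (simp add: field_simps)
    moreover have "(1 + \<epsilon>) / lam\<^sup>2 * d \<ge> 0" "k * w \<ge> 0" "k * d \<ge> 0" "k / lam\<^sup>2 * d \<ge> 0"
      using that eps k0 k1 w0 by simp_all
    ultimately show ?thesis
      using w0 that unfolding C_def w_def[symmetric] distrib_left distrib_right by linarith
  qed
  have key2: "(cmod b)\<^sup>2 + d \<le> (1 + \<epsilon>) * lam\<^sup>2 * ((cmod a)\<^sup>2 + d) + C * ((cmod (b - lam * a))\<^sup>2 / (1 + lam\<^sup>2) + d)"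
    if "d \<ge> 0" for a b :: complex and d :: real
  proof -
    define w where "w = (cmod (b - lam * a))\<^sup>2 / (1 + lam\<^sup>2)"
    have w0: "w \<ge> 0" by (simp add: w_def)
    have "(cmod b)\<^sup>2 \<le> (1 + \<epsilon>) * (cmod (lam * a))\<^sup>2 + k * w"
      using norm_sq_split[OF eps, of b "lam * a"] by (simp add: cs w_def)
    then have "(cmod b)\<^sup>2 \<le> (1 + \<epsilon>) * lam\<^sup>2 * (cmod a)\<^sup>2 + k * w"
      by (simp add: norm_mult power_mult_distrib mult.assoc)
    moreover have "(1 + \<epsilon>) * lam\<^sup>2 * d \<ge> 0" "k / lam\<^sup>2 * w \<ge> 0" "k * d \<ge> 0" "k / lam\<^sup>2 * d \<ge> 0"
      using that eps k0 k1 w0 by simp_all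
    ultimately show ?thesis
      using w0 that unfolding C_def w_def[symmetric] distrib_left distrib_right by linarith
  qed
  show "occ f x \<le> exp (\<eta> - 2 * ln lam) * occ f y + C * bform lam x y f"
    unfolding eqs e1 sum_distrib_left sum.distrib[symmetric]
    by (rule sum_mono) (use key1 in simp)
  show "occ f y \<le> exp (\<eta> + 2 * ln lam) * occ f x + C * bform lam x y f"
    unfolding eqs e2 sum_distrib_left sum.distrib[symmetric]
    by (rule sum_mono) (use key2 in simp)
qed

section \<open>Energy and particle number\<close>

definition bonds :: "site set \<Rightarrow> (site \<times> nat) set" where
  "bonds D = {(x, j). j \<in> {1, 2} \<and> x \<in> D \<and> nb x j \<in> D}"

definition touching :: "site set \<Rightarrow> site set \<Rightarrow> (site \<times> nat) set" where
  "touching D F = {(x, j). j \<in> {1, 2} \<and> x \<in> D \<and> nb x j \<in> D \<and> (x \<in> F \<or> nb x j \<in> F)}"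

lemma nb_neq: "x \<noteq> nb x j" "nb x j \<noteq> x"
  by (auto simp: nb_def prod_eq_iff)

lemma nb_inj: "nb x j = nb y j \<longleftrightarrow> x = y"
  by (auto simp: nb_def prod_eq_iff)

lemma touching_subset: "touching D F \<subseteq> bonds D"
  by (auto simp: touching_def bonds_def)

lemma finite_touching:
  assumes "finite F"
  shows "finite (touching D F)"
proof -
  have "touching D F \<subseteq> (F \<union> (\<lambda>z. (fst z - 1, snd z)) ` F \<union> (\<lambda>z. (fst z, snd z - 1)) ` F) \<times> {1, 2}"
    by (force simp: touching_def nb_def image_iff)
  then show ?thesis
    by (rule finite_subset) (simp add: assms)
qed

text \<open>Bonds that miss S contribute zero, so the bond set in \<open>Hmat\<close>, which depends
  on S, may be enlarged. One finite set then serves all configurations of a core vector at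
  once.\<close>

lemma Hmat_eq_sum:
  assumes "finite B" "touching D S \<subseteq> B" "B \<subseteq> bonds D"
  shows "Hmat l1 l2 D T S = (\<Sum>(x, j)\<in>B. bond_elem (lam_of l1 l2 j) x (nb x j) T S)"
  unfolding Hmat_def touching_def[symmetric]
proof (rule sum.mono_neutral_left)
  show "\<forall>b\<in>B - touching D S. (case b of (x, j) \<Rightarrow> bond_elem (lam_of l1 l2 j) x (nb x j) T S) = 0"
    using assms(3) by (force simp: touching_def bonds_def intro!: bond_elem_outside)
qed (use assms in auto)

lemma Hmat_sym:
  assumes "finite S" "finite T"
  shows "Hmat l1 l2 D T S = Hmat l1 l2 D S T"
proof -
  let ?B = "touching D (S \<union> T)"
  have B: "finite ?B" "touching D S \<subseteq> ?B" "touching D T \<subseteq> ?B" "?B \<subseteq> bonds D"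
    using assms by (auto simp: finite_touching) (auto simp: touching_def bonds_def)
  show ?thesis
    unfolding Hmat_eq_sum[OF B(1,2,4)] Hmat_eq_sum[OF B(1,3,4)]
    by (simp add: bond_elem_sym[of _ _ _ T S])
qed

lemma Hmat_real: "cnj (Hmat l1 l2 D T S) = Hmat l1 l2 D T S"
  unfolding Hmat_def cnj_sum by (rule sum.cong) (auto simp: bond_elem_def)

lemma Hmat_nonzeroE:
  assumes "Hmat l1 l2 D T S \<noteq> 0"
  obtains x j where "(x, j) \<in> touching D S" "bond_elem (lam_of l1 l2 j) x (nb x j) T S \<noteq> 0"
proof -
  have "\<exists>b\<in>touching D S. (case b of (x, j) \<Rightarrow> bond_elem (lam_of l1 l2 j) x (nb x j) T S) \<noteq> 0"
    using assms unfolding Hmat_def touching_def[symmetric] by (meson sum.not_neutral_contains_not_neutral)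
  then show thesis using that by auto
qed

lemma Hmat_card:
  assumes "Hmat l1 l2 D T S \<noteq> 0" "finite S"
  shows "card T = card S"
  using assms(1)
proof (rule Hmat_nonzeroE)
  fix x j assume "bond_elem (lam_of l1 l2 j) x (nb x j) T S \<noteq> 0"
  then show ?thesis
    using nb_neq(1) \<open>finite S\<close> by (rule bond_elem_card)
qed

lemma Hmat_subset:
  assumes "Hmat l1 l2 D T S \<noteq> 0"
  shows "T \<subseteq> S \<union> (\<Union>b\<in>touching D S. {fst b, nb (fst b) (snd b)})"
  using assms
proof (rule Hmat_nonzeroE)
  fix x j
  assume b: "(x, j) \<in> touching D S" "bond_elem (lam_of l1 l2 j) x (nb x j) T S \<noteq> 0"
  have "{x, nb x j} \<subseteq> (\<Union>b\<in>touching D S. {fst b, nb (fst b) (snd b)})"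
    using b(1) by force
  then show ?thesis
    using bond_elem_subset[OF b(2)] by blast
qed

lemma Hmat_vacuum: "Hmat l1 l2 D T {} = 0"
  by (simp add: Hmat_def)

lemma core_iff: "f \<in> core D \<longleftrightarrow> finite (supp f) \<and> supp f \<subseteq> configs D"
  by (auto simp: core_def supp_def)

lemma core_fin_supp: "f \<in> core D \<Longrightarrow> fin_supp f"
  by (auto simp: core_iff fin_supp_def configs_def)

lemma Hcore_eq:
  assumes "finite K" "supp f \<subseteq> K"
  shows "Hcore l1 l2 D f T = (\<Sum>S\<in>K. Hmat l1 l2 D T S * f S)"
  unfolding Hcore_def supp_def[symmetric]
  by (rule sum.mono_neutral_left) (use assms in \<open>auto simp: supp_def\<close>)

lemma Hcore_nonzeroE:
  assumes "T \<in> supp (Hcore l1 l2 D f)"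
  obtains S where "S \<in> supp f" "Hmat l1 l2 D T S \<noteq> 0"
proof -
  have "\<exists>S\<in>supp f. Hmat l1 l2 D T S * f S \<noteq> 0"
  proof (rule ccontr)
    assume "\<not> ?thesis"
    then have "Hcore l1 l2 D f T = 0"
      unfolding Hcore_def supp_def[symmetric] by (intro sum.neutral) blast
    then show False
      using assms by (simp add: supp_def)
  qed
  then show thesis using that by auto
qed

text \<open>Each bond term changes a configuration only on a bond that touches it and lies in D.
  Hence every configuration of the image sits inside one of finitely many finite sets
  \<open>?N S\<close>, all contained in D.\<close>

lemma Hcore_core:
  assumes "f \<in> core D"
  shows "Hcore l1 l2 D f \<in> core D"
proof -
  let ?N = "\<lambda>S. S \<union> (\<Union>b\<in>touching D S. {fst b, nb (fst b) (snd b)})"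
  have S: "finite (?N S) \<and> ?N S \<subseteq> D" if "S \<in> supp f" for S
  proof -
    have S: "finite S" "S \<subseteq> D"
      using that assms by (auto simp: core_iff configs_def)
    then show ?thesis
      using finite_touching[OF S(1), of D] touching_subset[of D S] by (auto simp: bonds_def)
  qed
  have T: "\<exists>S\<in>supp f. T \<subseteq> ?N S" if "T \<in> supp (Hcore l1 l2 D f)" for T
    using that
  proof (rule Hcore_nonzeroE)
    fix S assume S: "S \<in> supp f" "Hmat l1 l2 D T S \<noteq> 0"
    show ?thesis
      using Hmat_subset[OF S(2)] S(1) by (rule bexI)
  qed
  then have "supp (Hcore l1 l2 D f) \<subseteq> (\<Union>S\<in>supp f. Pow (?N S))"
    by blast
  moreover have "finite (\<Union>S\<in>supp f. Pow (?N S))"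
    using S assms by (auto simp: core_iff)
  moreover have "supp (Hcore l1 l2 D f) \<subseteq> configs D"
  proof
    fix T assume "T \<in> supp (Hcore l1 l2 D f)"
    then obtain S where S': "S \<in> supp f" "T \<subseteq> ?N S"
      using T by blast
    show "T \<in> configs D"
      using S[OF S'(1)] finite_subset[OF S'(2)] subset_trans[OF S'(2)] by (simp add: configs_def)
  qed
  ultimately show ?thesis
    by (auto simp: core_iff intro: finite_subset)
qed

lemma core_add_scale:
  assumes "f \<in> core D" "g \<in> core D"
  shows "(\<lambda>S. f S + a * g S) \<in> core D"
proof -
  have "supp (\<lambda>S. f S + a * g S) \<subseteq> supp f \<union> supp g"
    by (auto simp: supp_def)
  then show ?thesis
    using assms by (auto simp: core_iff intro: finite_subset)
qed

lemma Hcore_add_scale: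
  assumes "f \<in> core D" "g \<in> core D"
  shows "Hcore l1 l2 D (\<lambda>S. f S + a * g S) T = Hcore l1 l2 D f T + a * Hcore l1 l2 D g T"
proof -
  let ?K = "supp f \<union> supp g"
  have K: "finite ?K" "supp f \<subseteq> ?K" "supp g \<subseteq> ?K" "supp (\<lambda>S. f S + a * g S) \<subseteq> ?K"
    using assms by (auto simp: core_iff) (auto simp: supp_def)
  show ?thesis
    unfolding Hcore_eq[OF K(1,2)] Hcore_eq[OF K(1,3)] Hcore_eq[OF K(1,4)]
    by (simp add: algebra_simps sum.distrib sum_distrib_left)
qed

text \<open>The real part of the inner product; it suffices because only real multiples are
  expanded. Summing over the support of the first argument keeps the sum finite whatever the second
  one is, as long as the first is a core vector.\<close>

definition ip :: "vec \<Rightarrow> vec \<Rightarrow> real" where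
  "ip f g = (\<Sum>S\<in>supp f. Re (cnj (f S) * g S))"

lemma ip_eq:
  assumes "finite K" "supp f \<subseteq> K"
  shows "ip f g = (\<Sum>S\<in>K. Re (cnj (f S) * g S))"
  unfolding ip_def by (rule sum.mono_neutral_left) (use assms in \<open>auto simp: supp_def\<close>)

lemma ip_commute:
  assumes "finite (supp f)" "finite (supp g)"
  shows "ip f g = ip g f"
proof -
  have "finite (supp f \<union> supp g)"
    using assms by simp
  then show ?thesis
    by (simp add: ip_eq[of "supp f \<union> supp g"] mult.commute)
qed

lemma ip_add_scale_right: "ip f (\<lambda>S. g S + of_real a * h S) = ip f g + a * ip f h"
  by (simp add: ip_def algebra_simps sum.distrib sum_distrib_left)

lemma ip_Hcore_commute:
  assumes "f \<in> core D" "g \<in> core D"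
  shows "ip f (Hcore l1 l2 D g) = ip g (Hcore l1 l2 D f)"
proof -
  have fin: "finite S" if "S \<in> supp f \<union> supp g" for S
    using that assms by (auto simp: core_iff configs_def)
  have "ip f (Hcore l1 l2 D g) = (\<Sum>T\<in>supp f. \<Sum>S\<in>supp g. Re (cnj (f T) * (Hmat l1 l2 D T S * g S)))"
    by (simp add: ip_def Hcore_def supp_def[symmetric] sum_distrib_left)
  also have "\<dots> = (\<Sum>S\<in>supp g. \<Sum>T\<in>supp f. Re (cnj (f T) * (Hmat l1 l2 D T S * g S)))"
    by (rule sum.swap)
  also have "\<dots> = (\<Sum>S\<in>supp g. \<Sum>T\<in>supp f. Re (cnj (g S) * (Hmat l1 l2 D S T * f T)))"
  proof (intro sum.cong refl)
    fix S T assume "S \<in> supp g" "T \<in> supp f"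
    then have "Hmat l1 l2 D T S = Hmat l1 l2 D S T"
      using fin by (intro Hmat_sym) auto
    then have "cnj (g S) * (Hmat l1 l2 D S T * f T) = cnj (cnj (f T) * (Hmat l1 l2 D T S * g S))"
      by (simp add: Hmat_real mult_ac)
    then show "Re (cnj (f T) * (Hmat l1 l2 D T S * g S)) = Re (cnj (g S) * (Hmat l1 l2 D S T * f T))"
      by (simp only: cnj.simps(1))
  qed
  also have "\<dots> = ip g (Hcore l1 l2 D f)"
    by (simp add: ip_def Hcore_def supp_def[symmetric] sum_distrib_left)
  finally show ?thesis .
qed

lemma energy_eq:
  assumes f: "f \<in> core D" and B: "finite B" "touching D (\<Union>(supp f)) \<subseteq> B" "B \<subseteq> bonds D"
  shows "ip f (Hcore l1 l2 D f) = (\<Sum>(x, j)\<in>B. bform (lam_of l1 l2 j) x (nb x j) f)"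
proof -
  have H: "Hmat l1 l2 D T S = (\<Sum>(x, j)\<in>B. bond_elem (lam_of l1 l2 j) x (nb x j) T S)"
    if "S \<in> supp f" for S T
    by (rule Hmat_eq_sum) (use B that in \<open>auto simp: touching_def\<close>)
  have "ip f (Hcore l1 l2 D f) = (\<Sum>T\<in>supp f. \<Sum>S\<in>supp f. Re (cnj (f T) * (Hmat l1 l2 D T S * f S)))"
    by (simp add: ip_def Hcore_def supp_def[symmetric] sum_distrib_left)
  also have "\<dots> = (\<Sum>T\<in>supp f. \<Sum>S\<in>supp f. \<Sum>(x, j)\<in>B.
      Re (cnj (f T) * (bond_elem (lam_of l1 l2 j) x (nb x j) T S * f S)))"
    by (intro sum.cong refl) (simp add: H sum_distrib_left sum_distrib_right case_prod_unfold)
  also have "\<dots> = (\<Sum>T\<in>supp f. \<Sum>(x, j)\<in>B. \<Sum>S\<in>supp f.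
      Re (cnj (f T) * (bond_elem (lam_of l1 l2 j) x (nb x j) T S * f S)))"
    unfolding case_prod_unfold by (intro sum.cong refl sum.swap)
  also have "\<dots> = (\<Sum>(x, j)\<in>B. \<Sum>T\<in>supp f. \<Sum>S\<in>supp f.
      Re (cnj (f T) * (bond_elem (lam_of l1 l2 j) x (nb x j) T S * f S)))"
    unfolding case_prod_unfold by (rule sum.swap)
  finally show ?thesis
    by (simp add: bform_def)
qed

lemma core_sites:
  assumes "f \<in> core D"
  shows "finite (\<Union>(supp f))" "\<Union>(supp f) \<subseteq> D"
  using assms by (auto simp: core_iff configs_def)

text \<open>All bond terms are nonnegative, so any finite family of bonds in D costs at most the
  full energy. The bonds used along a path are paid for in this way.\<close>

lemma sum_bform_le_energy:
  assumes f: "f \<in> core D" and B: "finite B" "B \<subseteq> bonds D"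
  shows "(\<Sum>(x, j)\<in>B. bform (lam_of l1 l2 j) x (nb x j) f) \<le> ip f (Hcore l1 l2 D f)"
proof -
  let ?B = "B \<union> touching D (\<Union>(supp f))"
  have fin: "finite ?B"
    using B core_sites[OF f] by (simp add: finite_touching)
  have "ip f (Hcore l1 l2 D f) = (\<Sum>(x, j)\<in>?B. bform (lam_of l1 l2 j) x (nb x j) f)"
    by (rule energy_eq) (use f fin B touching_subset in auto)
  moreover have "(\<Sum>(x, j)\<in>B. bform (lam_of l1 l2 j) x (nb x j) f) \<le> (\<Sum>(x, j)\<in>?B. bform (lam_of l1 l2 j) x (nb x j) f)"
    by (rule sum_mono2) (use fin f in \<open>auto intro!: bform_nonneg core_fin_supp nb_neq\<close>)
  ultimately show ?thesis by simp
qed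

section \<open>Particle number as an upper bound for the energy\<close>

definition number :: "vec \<Rightarrow> real" where
  "number f = (\<Sum>S\<in>supp f. real (card S) * (cmod (f S))\<^sup>2)"

lemma occ_outside: "x \<notin> \<Union>(supp f) \<Longrightarrow> occ f x = 0"
  by (auto simp: occ_def intro!: sum.neutral)

lemma sum_occ:
  assumes "f \<in> core D"
  shows "(\<Sum>x\<in>\<Union>(supp f). occ f x) = number f"
proof -
  let ?F = "\<Union>(supp f)"
  have "(\<Sum>x\<in>?F. occ f x) = (\<Sum>S\<in>supp f. \<Sum>x\<in>?F. if x \<in> S then (cmod (f S))\<^sup>2 else 0)"
    unfolding occ_def by (rule sum.swap)
  also have "\<dots> = number f"
    unfolding number_def
  proof (rule sum.cong)
    fix S assume "S \<in> supp f"
    then have "?F \<inter> S = S" by auto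
    then show "(\<Sum>x\<in>?F. if x \<in> S then (cmod (f S))\<^sup>2 else 0) = real (card S) * (cmod (f S))\<^sup>2"
      using core_sites(1)[OF assms] by (simp add: sum.If_cases)
  qed simp
  finally show ?thesis .
qed

text \<open>An injective map visits each site at most once, and sites outside all configurations
  carry no occupation. It is applied to translations.\<close>

lemma sum_occ_inj_le:
  assumes "f \<in> core D" "finite X" "inj_on h X"
  shows "(\<Sum>x\<in>X. occ f (h x)) \<le> number f"
proof -
  let ?F = "\<Union>(supp f)"
  have "(\<Sum>x\<in>X. occ f (h x)) = (\<Sum>y\<in>h ` X. occ f y)"
    using sum.reindex[OF assms(3), of "occ f"] by (simp add: o_def)
  also have "\<dots> \<le> (\<Sum>y\<in>h ` X \<union> ?F. occ f y)"
    by (rule sum_mono2) (use assms core_sites in \<open>auto simp: occ_nonneg\<close>)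
  also have "\<dots> = (\<Sum>y\<in>?F. occ f y)"
    by (rule sum.mono_neutral_right) (use assms core_sites in \<open>auto intro: occ_outside\<close>)
  finally show ?thesis
    by (simp add: sum_occ[OF assms(1)])
qed

text \<open>Each bond costs at most the occupation of its two ends, and a site is an end of at most
  four bonds: the lower and the upper end once in each direction.\<close>

lemma energy_le_number:
  assumes f: "f \<in> core D"
  shows "ip f (Hcore l1 l2 D f) \<le> 4 * number f"
proof -
  let ?B = "touching D (\<Union>(supp f))"
  define X where "X = fst ` ?B"
  have fin: "finite ?B"
    using core_sites[OF f] by (simp add: finite_touching)
  have X: "finite X" "?B \<subseteq> X \<times> {1, 2}"
    using fin by (auto simp: X_def touching_def) force+
  have "ip f (Hcore l1 l2 D f) = (\<Sum>(x, j)\<in>?B. bform (lam_of l1 l2 j) x (nb x j) f)"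
    by (rule energy_eq) (use f fin touching_subset in auto)
  also have "\<dots> \<le> (\<Sum>(x, j)\<in>?B. occ f x + occ f (nb x j))"
    by (rule sum_mono) (use f in \<open>auto intro!: bform_le_occ core_fin_supp nb_neq\<close>)
  also have "\<dots> \<le> (\<Sum>(x, j)\<in>X \<times> {1, 2}. occ f x + occ f (nb x j))"
    by (rule sum_mono2) (use X in \<open>auto simp: occ_nonneg add_nonneg_nonneg\<close>)
  also have "\<dots> = 2 * (\<Sum>x\<in>X. occ f x) + (\<Sum>x\<in>X. occ f (nb x 1)) + (\<Sum>x\<in>X. occ f (nb x 2))"
    by (subst sum.cartesian_product[symmetric]) (simp add: sum.distrib sum_distrib_left)
  also have "\<dots> \<le> 2 * number f + number f + number f"
    using sum_occ_inj_le[OF f X(1), of "\<lambda>x. x"] sum_occ_inj_le[OF f X(1), of "\<lambda>x. nb x 1"]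
      sum_occ_inj_le[OF f X(1), of "\<lambda>x. nb x 2"]
    by (simp add: inj_on_def nb_inj)
  finally show ?thesis by simp
qed

section \<open>Transport of occupation along translates\<close>

text \<open>Up to a multiple of the energy, \<open>\<alpha>\<close> bounds the ratio of the occupation of \<open>X + u\<close> to that of \<open>X + v\<close>.\<close>

definition transport :: "real \<Rightarrow> real \<Rightarrow> site set \<Rightarrow> real \<Rightarrow> site \<Rightarrow> site \<Rightarrow> bool" where
  "transport l1 l2 D \<alpha> u v \<longleftrightarrow> (\<exists>C\<ge>0. \<forall>f\<in>core D. \<forall>X. finite X \<longrightarrow> X \<subseteq> D \<longrightarrow>
     (\<Sum>x\<in>X. occ f (x + u)) \<le> \<alpha> * (\<Sum>x\<in>X. occ f (x + v)) + C * ip f (Hcore l1 l2 D f))"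

lemma transport_refl: "transport l1 l2 D 1 u u"
  by (auto simp: transport_def intro: exI[of _ 0])

lemma transport_trans:
  assumes uv: "transport l1 l2 D \<alpha> u v" and vw: "transport l1 l2 D \<beta> v w" and "\<alpha> \<ge> 0"
  shows "transport l1 l2 D (\<alpha> * \<beta>) u w"
proof -
  obtain A where A: "A \<ge> 0" "\<And>f X. f \<in> core D \<Longrightarrow> finite X \<Longrightarrow> X \<subseteq> D \<Longrightarrow>
     (\<Sum>x\<in>X. occ f (x + u)) \<le> \<alpha> * (\<Sum>x\<in>X. occ f (x + v)) + A * ip f (Hcore l1 l2 D f)"
    using uv unfolding transport_def by metis
  obtain B where B: "B \<ge> 0" "\<And>f X. f \<in> core D \<Longrightarrow> finite X \<Longrightarrow> X \<subseteq> D \<Longrightarrow>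
     (\<Sum>x\<in>X. occ f (x + v)) \<le> \<beta> * (\<Sum>x\<in>X. occ f (x + w)) + B * ip f (Hcore l1 l2 D f)"
    using vw unfolding transport_def by metis
  have "(\<Sum>x\<in>X. occ f (x + u)) \<le> \<alpha> * \<beta> * (\<Sum>x\<in>X. occ f (x + w)) + (A + \<alpha> * B) * ip f (Hcore l1 l2 D f)"
    if "f \<in> core D" "finite X" "X \<subseteq> D" for f X
    using A(2)[OF that] mult_left_mono[OF B(2)[OF that] \<open>\<alpha> \<ge> 0\<close>] by (simp add: algebra_simps)
  moreover have "A + \<alpha> * B \<ge> 0"
    using A B \<open>\<alpha> \<ge> 0\<close> by simp
  ultimately show ?thesis
    unfolding transport_def by blast
qed

lemma nb_add: "nb (x + u) j = x + nb u j"
  by (simp add: nb_def prod_eq_iff)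

lemma transport_step:
  assumes "l1 > 0" "l2 > 0" "\<eta> > 0" and j: "j \<in> {1, 2}"
    and D: "\<And>x. x \<in> D \<Longrightarrow> x + u \<in> D \<and> x + nb u j \<in> D"
  shows "transport l1 l2 D (exp (\<eta> - 2 * ln (lam_of l1 l2 j))) u (nb u j)"
    and "transport l1 l2 D (exp (\<eta> + 2 * ln (lam_of l1 l2 j))) (nb u j) u"
proof -
  define lam where "lam = lam_of l1 l2 j"
  have "lam > 0" using assms by (simp add: lam_def lam_of_def)
  obtain C where C: "C \<ge> 0"
    "\<And>f x y. fin_supp f \<Longrightarrow> x \<noteq> y \<Longrightarrow> occ f x \<le> exp (\<eta> - 2 * ln lam) * occ f y + C * bform lam x y f"
    "\<And>f x y. fin_supp f \<Longrightarrow> x \<noteq> y \<Longrightarrow> occ f y \<le> exp (\<eta> + 2 * ln lam) * occ f x + C * bform lam x y f"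
    using occ_step[OF \<open>lam > 0\<close> \<open>\<eta> > 0\<close>] by metis
  have E: "C * (\<Sum>x\<in>X. bform lam (x + u) (x + nb u j) f) \<le> C * ip f (Hcore l1 l2 D f)"
    if f: "f \<in> core D" and X: "finite X" "X \<subseteq> D" for f X
  proof (rule mult_left_mono)
    \<comment> \<open>Distinct x give distinct bonds, so the sum over X is a partial energy. This is
      why the constant does not depend on X.\<close>
    let ?h = "\<lambda>x. (x + u, j)"
    have "(\<Sum>(x, i)\<in>?h ` X. bform (lam_of l1 l2 i) x (nb x i) f) \<le> ip f (Hcore l1 l2 D f)"
      by (rule sum_bform_le_energy) (use f X D j in \<open>auto simp: bonds_def nb_add\<close>)
    moreover have "(\<Sum>(x, i)\<in>?h ` X. bform (lam_of l1 l2 i) x (nb x i) f) = (\<Sum>x\<in>X. bform lam (x + u) (x + nb u j) f)"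
      by (subst sum.reindex) (auto simp: inj_on_def lam_def nb_add)
    ultimately show "(\<Sum>x\<in>X. bform lam (x + u) (x + nb u j) f) \<le> ip f (Hcore l1 l2 D f)"
      by simp
  qed (fact C(1))
  have ne: "x + u \<noteq> x + nb u j" for x
    using nb_neq by simp
  have 1: "(\<Sum>x\<in>X. occ f (x + u)) \<le> exp (\<eta> - 2 * ln lam) * (\<Sum>x\<in>X. occ f (x + nb u j)) + C * ip f (Hcore l1 l2 D f)"
    if "f \<in> core D" "finite X" "X \<subseteq> D" for f X
  proof -
    have "(\<Sum>x\<in>X. occ f (x + u)) \<le> (\<Sum>x\<in>X. exp (\<eta> - 2 * ln lam) * occ f (x + nb u j) + C * bform lam (x + u) (x + nb u j) f)"
      by (rule sum_mono) (rule C(2)[OF core_fin_supp[OF that(1)] ne])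
    then show ?thesis
      using E[OF that] by (simp add: sum.distrib sum_distrib_left)
  qed
  have 2: "(\<Sum>x\<in>X. occ f (x + nb u j)) \<le> exp (\<eta> + 2 * ln lam) * (\<Sum>x\<in>X. occ f (x + u)) + C * ip f (Hcore l1 l2 D f)"
    if "f \<in> core D" "finite X" "X \<subseteq> D" for f X
  proof -
    have "(\<Sum>x\<in>X. occ f (x + nb u j)) \<le> (\<Sum>x\<in>X. exp (\<eta> + 2 * ln lam) * occ f (x + u) + C * bform lam (x + u) (x + nb u j) f)"
      by (rule sum_mono) (rule C(3)[OF core_fin_supp[OF that(1)] ne])
    then show ?thesis
      using E[OF that] by (simp add: sum.distrib sum_distrib_left)
  qed
  show "transport l1 l2 D (exp (\<eta> - 2 * ln (lam_of l1 l2 j))) u (nb u j)"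
    unfolding transport_def lam_def[symmetric] using 1 C(1) by (intro exI[of _ C]) simp
  show "transport l1 l2 D (exp (\<eta> + 2 * ln (lam_of l1 l2 j))) (nb u j) u"
    unfolding transport_def lam_def[symmetric] using 2 C(1) by (intro exI[of _ C]) simp
qed

section \<open>Coercivity on half-planes\<close>

definition shift :: "site \<Rightarrow> nat \<Rightarrow> int \<Rightarrow> site" where
  "shift u j k = (if j = 1 then (fst u + k, snd u) else (fst u, snd u + k))"

lemma shift_nb: "shift u j (k + 1) = nb (shift u j k) j"
  by (simp add: shift_def nb_def)

text \<open>The inner product with m. Nonnegative height of an offset u means that translation by u
  maps the half-plane into itself, so a path of such offsets is admissible from all starting sites
  simultaneously.\<close>

definition height :: "real \<Rightarrow> real \<Rightarrow> site \<Rightarrow> real" where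
  "height m1 m2 u = m1 * real_of_int (fst u) + m2 * real_of_int (snd u)"

lemma half_plane_add:
  assumes "x \<in> half_plane m1 m2" "height m1 m2 u \<ge> 0"
  shows "x + u \<in> half_plane m1 m2"
  using assms by (simp add: half_plane_def height_def algebra_simps)

lemma height_shift: "height m1 m2 (shift u j k) = height m1 m2 u + real_of_int k * (if j = 1 then m1 else m2)"
  by (simp add: height_def shift_def algebra_simps)

text \<open>Height is affine along a straight leg. The inductions along a leg therefore need
  assumptions on its two ends only.\<close>

lemma affine_between_nonneg:
  fixes h c :: real
  assumes "h \<ge> 0" "h + (real n + 1) * c \<ge> 0"
  shows "h + real n * c \<ge> 0"
proof (cases "c \<ge> 0")
  case False
  then have "(real n + 1) * c \<le> real n * c"
    by (simp add: algebra_simps)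
  then show ?thesis using assms by linarith
qed (use assms in simp)

lemma transport_up:
  assumes l: "l1 > 0" "l2 > 0" "\<eta> > 0" "j \<in> {1, 2}"
    and u: "height m1 m2 u \<ge> 0" "height m1 m2 (shift u j (int n)) \<ge> 0"
  shows "transport l1 l2 (half_plane m1 m2) (exp (real n * (\<eta> - 2 * ln (lam_of l1 l2 j)))) u (shift u j (int n))"
  using u(2)
proof (induction n)
  case 0
  then show ?case
    by (simp add: shift_def transport_refl)
next
  case (Suc n)
  have h: "height m1 m2 (shift u j (int n)) \<ge> 0"
    using Suc.prems u(1) affine_between_nonneg[of "height m1 m2 u" n "if j = 1 then m1 else m2"]
    by (simp add: height_shift add.commute)
  have s: "shift u j (int (Suc n)) = nb (shift u j (int n)) j"
    using shift_nb[of u j "int n"] by (simp add: add.commute)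
  have "transport l1 l2 (half_plane m1 m2) (exp (\<eta> - 2 * ln (lam_of l1 l2 j))) (shift u j (int n)) (shift u j (int (Suc n)))"
    unfolding s by (rule transport_step(1)) (use l h Suc.prems s half_plane_add in auto)
  from transport_trans[OF Suc.IH[OF h] this]
  show ?case
    by (simp add: exp_add[symmetric] algebra_simps)
qed

lemma transport_down:
  assumes l: "l1 > 0" "l2 > 0" "\<eta> > 0" "j \<in> {1, 2}"
    and u: "height m1 m2 u \<ge> 0" "height m1 m2 (shift u j (- int n)) \<ge> 0"
  shows "transport l1 l2 (half_plane m1 m2) (exp (real n * (\<eta> + 2 * ln (lam_of l1 l2 j)))) u (shift u j (- int n))"
  using u(2)
proof (induction n)
  case 0
  then show ?case
    by (simp add: shift_def transport_refl)
next
  case (Suc n)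
  have h: "height m1 m2 (shift u j (- int n)) \<ge> 0"
    using Suc.prems u(1) affine_between_nonneg[of "height m1 m2 u" n "- (if j = 1 then m1 else m2)"]
    by (simp add: height_shift algebra_simps split: if_splits)
  \<comment> \<open>A bond is indexed by its lower end. Going down, the old offset is the upper end
    of the new bond, which calls for the reversed inequality with the sign of log \<lambda>
    changed.\<close>
  have s: "shift u j (- int n) = nb (shift u j (- int (Suc n))) j"
    using shift_nb[of u j "- int (Suc n)"] by simp
  have "transport l1 l2 (half_plane m1 m2) (exp (\<eta> + 2 * ln (lam_of l1 l2 j))) (shift u j (- int n)) (shift u j (- int (Suc n)))"
    unfolding s by (rule transport_step(2)) (use l h Suc.prems s half_plane_add in auto)
  from transport_trans[OF Suc.IH[OF h] this]
  show ?case
    by (simp add: exp_add[symmetric] algebra_simps)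
qed

text \<open>The loss \<eta> is paid on every bond whatever the direction, hence |k|; the gain from
  \<lambda> is signed, hence k.\<close>

lemma transport_shift:
  assumes "l1 > 0" "l2 > 0" "\<eta> > 0" "j \<in> {1, 2}"
    and "height m1 m2 u \<ge> 0" "height m1 m2 (shift u j k) \<ge> 0"
  shows "transport l1 l2 (half_plane m1 m2)
    (exp (real_of_int \<bar>k\<bar> * \<eta> - 2 * real_of_int k * ln (lam_of l1 l2 j))) u (shift u j k)"
proof (cases "k \<ge> 0")
  case True
  then obtain n where "k = int n" by (metis nonneg_int_cases)
  then show ?thesis
    using transport_up[OF assms(1-5), of n] assms(6) by (simp add: algebra_simps)
next
  case False
  then obtain n where "k = - int n" by (metis linear nonpos_int_cases)
  then show ?thesis
    using transport_down[OF assms(1-5), of n] assms(6) by (simp add: algebra_simps)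
qed

text \<open>The heights of (a, 0) and (0, b) have a nonnegative sum, so at least one of these
  corners is admissible. The order of the two legs of the L is chosen to pass through it.\<close>

lemma transport_half_plane:
  assumes "l1 > 0" "l2 > 0" "\<eta> > 0"
    and ab: "m1 * real_of_int a + m2 * real_of_int b \<ge> 0"
  shows "transport l1 l2 (half_plane m1 m2)
    (exp (real_of_int (\<bar>a\<bar> + \<bar>b\<bar>) * \<eta> - 2 * (real_of_int a * ln l1 + real_of_int b * ln l2))) 0 (a, b)"
proof -
  let ?T = "transport l1 l2 (half_plane m1 m2)"
  let ?A = "exp (real_of_int \<bar>a\<bar> * \<eta> - 2 * real_of_int a * ln l1)"
  let ?B = "exp (real_of_int \<bar>b\<bar> * \<eta> - 2 * real_of_int b * ln l2)"
  have "?T (?A * ?B) 0 (a, b)"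
  proof (cases "m1 * real_of_int a \<ge> 0")
    case True
    have "?T ?A 0 (a, 0)"
      using transport_shift[OF assms(1-3), of 1 m1 m2 0 a] True
      by (simp add: shift_def height_def lam_of_def)
    moreover have "?T ?B (a, 0) (a, b)"
      using transport_shift[OF assms(1-3), of 2 m1 m2 "(a, 0)" b] True ab
      by (simp add: shift_def height_def lam_of_def)
    ultimately show ?thesis
      by (rule transport_trans) simp
  next
    case False
    then have b: "m2 * real_of_int b \<ge> 0" using ab by linarith
    have "?T ?B 0 (0, b)"
      using transport_shift[OF assms(1-3), of 2 m1 m2 0 b] b
      by (simp add: shift_def height_def lam_of_def)
    moreover have "?T ?A (0, b) (a, b)"
      using transport_shift[OF assms(1-3), of 1 m1 m2 "(0, b)" a] b ab
      by (simp add: shift_def height_def lam_of_def)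
    ultimately have "?T (?B * ?A) 0 (a, b)"
      by (rule transport_trans) simp
    then show ?thesis by (simp add: mult.commute)
  qed
  then show ?thesis
    by (simp add: exp_add[symmetric] algebra_simps)
qed

text \<open>A real vector w with strictly positive inner products with both L and m is found; a
  large multiple of w is then rounded to the lattice. The inner products grow linearly with the
  multiple while the rounding error stays bounded.\<close>

lemma growth_direction:
  fixes L1 L2 m1 m2 :: real
  assumes m: "m1\<^sup>2 + m2\<^sup>2 = 1"
    and ne: "(L1, L2) \<noteq> (- sqrt (L1\<^sup>2 + L2\<^sup>2) * m1, - sqrt (L1\<^sup>2 + L2\<^sup>2) * m2)"
  obtains a b :: int where "m1 * a + m2 * b \<ge> 0" "L1 * a + L2 * b > 0"
proof -
  define r where "r = sqrt (L1\<^sup>2 + L2\<^sup>2)"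
  have r0: "r \<ge> 0" and r2: "r\<^sup>2 = L1\<^sup>2 + L2\<^sup>2"
    by (simp_all add: r_def)
  \<comment> \<open>The bisector of \<open>L\<close> and \<open>m\<close>; its inner products with both are nonnegative, and positive unless \<open>L = - \<bar>L\<bar> m\<close>.\<close>
  define w1 w2 where "w1 = L1 + r * m1" and "w2 = L2 + r * m2"
  define p where "p = m1 * w1 + m2 * w2"
  define q where "q = L1 * w1 + L2 * w2"
  have "w1 \<noteq> 0 \<or> w2 \<noteq> 0"
    using ne by (auto simp: w1_def w2_def r_def)
  then have "w1\<^sup>2 + w2\<^sup>2 > 0"
    by (simp add: sum_power2_gt_zero_iff)
  also have "w1\<^sup>2 + w2\<^sup>2 = q + r * p"
    by (simp add: w1_def w2_def p_def q_def algebra_simps power2_eq_square)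
  finally have pos: "q + r * p > 0" .
  \<comment> \<open>L and r m have the same length r, because m is a unit vector, so their sum w has
    the same inner product with both. As q + r p is |w|^2, both terms equal half of it.\<close>
  have qp: "q = r * p"
  proof -
    have "q = L1\<^sup>2 + L2\<^sup>2 + r * (L1 * m1 + L2 * m2)"
      by (simp add: q_def w1_def w2_def algebra_simps power2_eq_square)
    moreover have "p = L1 * m1 + L2 * m2 + r * (m1\<^sup>2 + m2\<^sup>2)"
      by (simp add: p_def w1_def w2_def algebra_simps power2_eq_square)
    ultimately show ?thesis
      unfolding m using r2 by (simp add: algebra_simps power2_eq_square)
  qed
  have q0: "q > 0" using pos qp by linarith
  then have p0: "p > 0" using qp r0 by (metis mult_nonneg_nonpos not_le)
  \<comment> \<open>Large enough for both margins to absorb the errors of rounding down two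
    coordinates; the extra 1 makes the second inequality strict.\<close>
  define k where "k = max ((\<bar>m1\<bar> + \<bar>m2\<bar>) / p) ((\<bar>L1\<bar> + \<bar>L2\<bar> + 1) / q)"
  have k: "k * p \<ge> \<bar>m1\<bar> + \<bar>m2\<bar>" "k * q \<ge> \<bar>L1\<bar> + \<bar>L2\<bar> + 1"
    using p0 q0 by (simp_all add: k_def pos_divide_le_eq[symmetric])
  have near: "\<bar>c * of_int \<lfloor>z\<rfloor> - c * z\<bar> \<le> \<bar>c\<bar>" for c z :: real
  proof -
    have "\<bar>of_int \<lfloor>z\<rfloor> - z\<bar> \<le> 1" by linarith
    then have "\<bar>c\<bar> * \<bar>of_int \<lfloor>z\<rfloor> - z\<bar> \<le> \<bar>c\<bar> * 1"
      by (rule mult_left_mono) simp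
    moreover have "\<bar>c * of_int \<lfloor>z\<rfloor> - c * z\<bar> = \<bar>c\<bar> * \<bar>of_int \<lfloor>z\<rfloor> - z\<bar>"
      by (simp only: right_diff_distrib[symmetric] abs_mult)
    ultimately show ?thesis by simp
  qed
  show thesis
  proof
    have "m1 * (k * w1) + m2 * (k * w2) = k * p"
      by (simp add: p_def algebra_simps)
    then show "m1 * of_int \<lfloor>k * w1\<rfloor> + m2 * of_int \<lfloor>k * w2\<rfloor> \<ge> 0"
      using near[of m1 "k * w1"] near[of m2 "k * w2"] k(1) by linarith
    have "L1 * (k * w1) + L2 * (k * w2) = k * q"
      by (simp add: q_def algebra_simps)
    then show "L1 * of_int \<lfloor>k * w1\<rfloor> + L2 * of_int \<lfloor>k * w2\<rfloor> > 0"
      using near[of L1 "k * w1"] near[of L2 "k * w2"] k(2) by linarith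
  qed
qed

lemma energy_nonneg:
  assumes "f \<in> core D"
  shows "ip f (Hcore l1 l2 D f) \<ge> 0"
  using sum_bform_le_energy[OF assms, of "{}"] by simp

lemma number_le_energy:
  assumes l: "l1 > 0" "l2 > 0" and m: "m1\<^sup>2 + m2\<^sup>2 = 1"
    and ne: "(ln l1, ln l2) \<noteq> (- sqrt ((ln l1)\<^sup>2 + (ln l2)\<^sup>2) * m1, - sqrt ((ln l1)\<^sup>2 + (ln l2)\<^sup>2) * m2)"
  shows "\<exists>\<delta>>0. \<forall>f\<in>core (half_plane m1 m2). \<delta> * number f \<le> ip f (Hcore l1 l2 (half_plane m1 m2) f)"
proof -
  let ?D = "half_plane m1 m2"
  obtain a b :: int where ab: "m1 * a + m2 * b \<ge> 0" "ln l1 * a + ln l2 * b > 0"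
    using growth_direction[OF m ne] .
  define g where "g = ln l1 * a + ln l2 * b"
  define n where "n = real_of_int (\<bar>a\<bar> + \<bar>b\<bar>)"
  have n: "n > 0"
  proof -
    have "a \<noteq> 0 \<or> b \<noteq> 0"
      using ab(2) by auto
    then have "\<bar>a\<bar> + \<bar>b\<bar> > 0"
      by linarith
    then show ?thesis
      unfolding n_def by linarith
  qed
  \<comment> \<open>The path has n bonds, so the total loss n \<eta> equals g, half of the gain 2 g.
    A factor exp (- g) < 1 remains.\<close>
  define \<eta> where "\<eta> = g / n"
  have "\<eta> > 0" using n ab(2) by (simp add: \<eta>_def g_def)
  have "transport l1 l2 ?D (exp (n * \<eta> - 2 * g)) 0 (a, b)"
    using transport_half_plane[OF l \<open>\<eta> > 0\<close> ab(1)] by (simp add: n_def g_def mult.commute)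
  moreover have "n * \<eta> - 2 * g = - g"
    using n by (simp add: \<eta>_def)
  ultimately have T: "transport l1 l2 ?D (exp (- g)) 0 (a, b)"
    by simp
  define q where "q = exp (- g)"
  have q: "q < 1" "q \<ge> 0" using ab(2) by (simp_all add: q_def g_def)
  obtain C where C: "C \<ge> 0" "\<And>f X. f \<in> core ?D \<Longrightarrow> finite X \<Longrightarrow> X \<subseteq> ?D \<Longrightarrow>
     (\<Sum>x\<in>X. occ f (x + 0)) \<le> q * (\<Sum>x\<in>X. occ f (x + (a, b))) + C * ip f (Hcore l1 l2 ?D f)"
    using T unfolding transport_def q_def by metis
  show ?thesis
  \<comment> \<open>The denominator is C + 1 because C may be zero.\<close>
  proof (intro exI[of _ "(1 - q) / (C + 1)"] conjI ballI)
    show "(1 - q) / (C + 1) > 0"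
      using q C(1) by simp
    fix f assume f: "f \<in> core ?D"
    note F = core_sites[OF f]
    \<comment> \<open>X is taken to be the set of all sites occupied in f, so the left-hand sum is
      the whole particle number, and the translated sum is at most that again.\<close>
    have "number f \<le> q * (\<Sum>x\<in>\<Union>(supp f). occ f (x + (a, b))) + C * ip f (Hcore l1 l2 ?D f)"
      using C(2)[OF f F] by (simp add: sum_occ[OF f])
    also have "\<dots> \<le> q * number f + C * ip f (Hcore l1 l2 ?D f)"
      using sum_occ_inj_le[OF f F(1), of "\<lambda>x. x + (a, b)"] q by (simp add: inj_on_def mult_left_mono)
    finally have "(1 - q) * number f \<le> C * ip f (Hcore l1 l2 ?D f)"
      by (simp add: algebra_simps)
    also have "\<dots> \<le> (C + 1) * ip f (Hcore l1 l2 ?D f)"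
      using energy_nonneg[OF f] by (simp add: algebra_simps)
    finally show "(1 - q) / (C + 1) * number f \<le> ip f (Hcore l1 l2 ?D f)"
      using C(1) by (simp add: field_simps)
  qed
qed

section \<open>Completeness of the Hilbert space\<close>

definition square_summable :: "vec \<Rightarrow> bool" where
  "square_summable f \<longleftrightarrow> (\<lambda>S. (cmod (f S))\<^sup>2) summable_on UNIV"

lemma L2_set_le_l2norm:
  assumes "square_summable f" "finite K"
  shows "L2_set (\<lambda>S. cmod (f S)) K \<le> l2norm f"
  unfolding L2_set_def l2norm_def real_sqrt_le_iff
  using assms unfolding square_summable_def by (intro finite_sum_le_infsum) auto

text \<open>Finite sections decide both summability and the norm bound. Summability has to come
  along, since \<open>infsum\<close> is 0 on a family that is not summable and a bound on
  \<open>l2norm\<close> alone would say nothing.\<close>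

lemma l2normI:
  assumes "\<And>K. finite K \<Longrightarrow> L2_set (\<lambda>S. cmod (f S)) K \<le> c"
  shows "square_summable f" "l2norm f \<le> c"
proof -
  have c: "c \<ge> 0"
    using assms[of "{}"] by simp
  have b: "(\<Sum>S\<in>K. (cmod (f S))\<^sup>2) \<le> c\<^sup>2" if "finite K" for K
    using assms[OF that] by (simp add: L2_set_def sqrt_le_D)
  show s: "square_summable f"
    unfolding square_summable_def
    by (rule nonneg_bdd_above_summable_on) (use b in \<open>auto simp: bdd_above_def\<close>)
  have "infsum (\<lambda>S. (cmod (f S))\<^sup>2) UNIV \<le> c\<^sup>2"
    by (rule infsum_le_finite_sums) (use s b in \<open>auto simp: square_summable_def\<close>)
  then show "l2norm f \<le> c"
    unfolding l2norm_def using c by (rule real_le_lsqrt[rotated])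
qed

lemma l2norm_nonneg: "l2norm f \<ge> 0"
  unfolding l2norm_def by (simp add: infsum_nonneg)

text \<open>Minkowski's inequality on finite sections. The combination is given by a pointwise
  equation so that the lemma applies to any algebraic rearrangement of it.\<close>

lemma l2norm_linear:
  assumes f: "square_summable f" and g: "square_summable g" and h: "\<And>S. h S = f S + a * g S"
  shows "square_summable h" "l2norm h \<le> l2norm f + cmod a * l2norm g"
proof -
  have "L2_set (\<lambda>S. cmod (h S)) K \<le> l2norm f + cmod a * l2norm g" if K: "finite K" for K
  proof -
    have "L2_set (\<lambda>S. cmod (h S)) K \<le> L2_set (\<lambda>S. cmod (f S) + cmod a * cmod (g S)) K"
      by (rule L2_set_mono) (auto simp: h norm_mult[symmetric] norm_triangle_ineq)
    also have "\<dots> \<le> L2_set (\<lambda>S. cmod (f S)) K + L2_set (\<lambda>S. cmod a * cmod (g S)) K"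
      by (rule L2_set_triangle_ineq)
    also have "L2_set (\<lambda>S. cmod a * cmod (g S)) K = cmod a * L2_set (\<lambda>S. cmod (g S)) K"
      by (simp add: L2_set_right_distrib)
    finally show ?thesis
      using L2_set_le_l2norm[OF f K] mult_left_mono[OF L2_set_le_l2norm[OF g K], of "cmod a"] by simp
  qed
  note * = l2normI[OF this]
  show "square_summable h" "l2norm h \<le> l2norm f + cmod a * l2norm g"
    using * by simp_all
qed

lemma l2norm_eq_0D:
  assumes "square_summable f" "l2norm f \<le> 0"
  shows "f S = 0"
proof -
  have "cmod (f S) \<le> l2norm f"
    using L2_set_le_l2norm[OF assms(1), of "{S}"] by simp
  then have "cmod (f S) \<le> 0"
    using assms(2) by linarith
  then show ?thesis by simp
qed

lemma square_summable_finite: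
  assumes "finite (supp f)"
  shows "square_summable f" "l2norm f = sqrt (ip f f)"
proof -
  have ip: "ip f f = (\<Sum>S\<in>supp f. (cmod (f S))\<^sup>2)"
    unfolding ip_def by (rule sum.cong) (simp, metis Re_complex_of_real complex_norm_square mult.commute)
  have hs: "((\<lambda>S. (cmod (f S))\<^sup>2) has_sum (\<Sum>S\<in>supp f. (cmod (f S))\<^sup>2)) UNIV"
    by (rule has_sum_finite_neutralI) (use assms in \<open>auto simp: supp_def\<close>)
  then show "square_summable f" "l2norm f = sqrt (ip f f)"
    unfolding square_summable_def l2norm_def ip
    by (auto simp: infsumI dest: has_sum_imp_summable)
qed

text \<open>The pointwise limit is the candidate; letting m tend to infinity in finite sections of
  the Cauchy estimate gives norm convergence. Pointwise convergence is recorded as well because it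
  transfers the support condition to the limit.\<close>

lemma l2_complete:
  fixes f :: "nat \<Rightarrow> vec"
  assumes sq: "\<And>n. square_summable (f n)"
    and cauchy: "\<And>e. e > 0 \<Longrightarrow> \<exists>N. \<forall>m\<ge>N. \<forall>n\<ge>N. l2norm (\<lambda>S. f m S - f n S) \<le> e"
  shows "\<exists>\<psi>. square_summable \<psi> \<and> (\<lambda>n. l2norm (\<lambda>S. f n S - \<psi> S)) \<longlonglongrightarrow> 0
    \<and> (\<forall>S. (\<lambda>n. f n S) \<longlonglongrightarrow> \<psi> S)"
proof -
  have sqd: "square_summable (\<lambda>S. f m S - f n S)" for m n
    using l2norm_linear(1)[OF sq sq, of _ m "-1" n] by simp
  have "\<exists>l. (\<lambda>n. f n S) \<longlonglongrightarrow> l" for S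
  proof -
    have "Cauchy (\<lambda>n. f n S)"
    proof (rule metric_CauchyI)
      fix e :: real assume "e > 0"
      then obtain N where N: "\<And>m n. m \<ge> N \<Longrightarrow> n \<ge> N \<Longrightarrow> l2norm (\<lambda>S. f m S - f n S) \<le> e / 2"
        using cauchy[of "e / 2"] by auto
      have "dist (f m S) (f n S) < e" if "m \<ge> N" "n \<ge> N" for m n
        using L2_set_le_l2norm[OF sqd[of m n], of "{S}"] N[OF that] \<open>e > 0\<close> by (simp add: dist_norm)
      then show "\<exists>N. \<forall>m\<ge>N. \<forall>n\<ge>N. dist (f m S) (f n S) < e"
        by blast
    qed
    then show ?thesis
      using Cauchy_convergent convergent_def by blast
  qed
  then obtain \<psi> where lim: "\<And>S. (\<lambda>n. f n S) \<longlonglongrightarrow> \<psi> S"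
    by metis
  have tail: "\<exists>N. \<forall>n\<ge>N. square_summable (\<lambda>S. f n S - \<psi> S) \<and> l2norm (\<lambda>S. f n S - \<psi> S) \<le> e"
    if "e > 0" for e
  proof -
    obtain N where N: "\<And>m n. m \<ge> N \<Longrightarrow> n \<ge> N \<Longrightarrow> l2norm (\<lambda>S. f m S - f n S) \<le> e"
      using cauchy[OF \<open>e > 0\<close>] by auto
    have "L2_set (\<lambda>S. cmod (f n S - \<psi> S)) K \<le> e" if "n \<ge> N" "finite K" for n K
    proof (rule LIMSEQ_le_const2)
      show "(\<lambda>m. L2_set (\<lambda>S. cmod (f n S - f m S)) K) \<longlonglongrightarrow> L2_set (\<lambda>S. cmod (f n S - \<psi> S)) K"
        unfolding L2_set_def by (intro tendsto_intros lim)
      have "L2_set (\<lambda>S. cmod (f n S - f m S)) K \<le> e" if "m \<ge> N" for m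
        using L2_set_le_l2norm[OF sqd[of n m] \<open>finite K\<close>] N[OF \<open>n \<ge> N\<close> that] by linarith
      then show "\<exists>N. \<forall>m\<ge>N. L2_set (\<lambda>S. cmod (f n S - f m S)) K \<le> e"
        by blast
    qed
    then have "square_summable (\<lambda>S. f n S - \<psi> S) \<and> l2norm (\<lambda>S. f n S - \<psi> S) \<le> e" if "n \<ge> N" for n
      using l2normI[of "\<lambda>S. f n S - \<psi> S" e] that by simp
    then show ?thesis
      by (intro exI[of _ N]) simp
  qed
  obtain n where n: "square_summable (\<lambda>S. f n S - \<psi> S)"
    using tail[of 1] by auto
  have "square_summable \<psi>"
    by (rule l2norm_linear(1)[OF sq[of n] n, of _ "-1"]) simp
  moreover have "(\<lambda>n. l2norm (\<lambda>S. f n S - \<psi> S)) \<longlonglongrightarrow> 0"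
  proof (rule LIMSEQ_I)
    fix e :: real assume "e > 0"
    then obtain N where N: "\<And>n. n \<ge> N \<Longrightarrow> l2norm (\<lambda>S. f n S - \<psi> S) \<le> e / 2"
      using tail[of "e / 2"] by auto
    have "norm (l2norm (\<lambda>S. f n S - \<psi> S) - 0) < e" if "n \<ge> N" for n
      using N[OF that] l2norm_nonneg[of "\<lambda>S. f n S - \<psi> S"] \<open>e > 0\<close> by simp
    then show "\<exists>N. \<forall>n\<ge>N. norm (l2norm (\<lambda>S. f n S - \<psi> S) - 0) < e"
      by blast
  qed
  ultimately show ?thesis
    using lim by (intro exI[of _ \<psi>]) simp
qed

text \<open>Truncation to a finite set of configurations that carries all but e^2 of the squared
  norm.\<close>

lemma core_dense:
  assumes f: "f \<in> l2space D" and "e > 0"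
  obtains g where "g \<in> core D" "l2norm (\<lambda>S. f S - g S) \<le> e"
proof -
  let ?s = "\<lambda>S. (cmod (f S))\<^sup>2"
  have sm: "?s summable_on UNIV" using f by (simp add: l2space_def)
  have "\<exists>K. finite K \<and> sum ?s K > infsum ?s UNIV - e\<^sup>2"
  proof (rule ccontr)
    assume "\<not> ?thesis"
    then have "infsum ?s UNIV \<le> infsum ?s UNIV - e\<^sup>2"
      using sm by (intro infsum_le_finite_sums) (auto simp: not_less)
    then show False using \<open>e > 0\<close> by simp
  qed
  then obtain K where K: "finite K" "sum ?s K > infsum ?s UNIV - e\<^sup>2"
    by blast
  define g where "g = (\<lambda>S. if S \<in> K then f S else 0)"
  show thesis
  proof
    show "g \<in> core D"
      using f K(1) by (auto simp: core_def g_def l2space_def)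
    show "l2norm (\<lambda>S. f S - g S) \<le> e"
    proof (rule l2normI)
      fix K' :: "config set" assume K': "finite K'"
      have "(\<Sum>S\<in>K'. (cmod (f S - g S))\<^sup>2) = (\<Sum>S\<in>K' - K. ?s S)"
        by (rule sum.mono_neutral_cong_right) (use K' in \<open>auto simp: g_def\<close>)
      also have "\<dots> + sum ?s K = sum ?s ((K' - K) \<union> K)"
        by (rule sum.union_disjoint[symmetric]) (use K K' in auto)
      also have "\<dots> \<le> infsum ?s UNIV"
        using K K' sm by (intro finite_sum_le_infsum) auto
      finally have "(\<Sum>S\<in>K'. (cmod (f S - g S))\<^sup>2) \<le> e\<^sup>2"
        using K(2) by linarith
      then show "L2_set (\<lambda>S. cmod (f S - g S)) K' \<le> e"
        unfolding L2_set_def using \<open>e > 0\<close> by (intro real_le_lsqrt) auto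
    qed
  qed
qed

section \<open>Density of the range\<close>

text \<open>\<open>H - t\<close> is negative on the vacuum and positive on its complement; composed with this sign flip it
  becomes coercive.\<close>

definition flip :: "vec \<Rightarrow> vec" where
  "flip f = (\<lambda>S. if S = {} then - f S else f S)"

definition Hshift :: "real \<Rightarrow> real \<Rightarrow> site set \<Rightarrow> real \<Rightarrow> vec \<Rightarrow> vec" where
  "Hshift l1 l2 D t f = (\<lambda>S. Hcore l1 l2 D f S + of_real (- t) * f S)"

lemma supp_flip [simp]: "supp (flip f) = supp f"
  by (auto simp: supp_def flip_def)

lemma flip_flip [simp]: "flip (flip f) = f"
  by (auto simp: flip_def)

lemma flip_core: "f \<in> core D \<Longrightarrow> flip f \<in> core D"
  by (simp add: core_iff)

lemma ip_flip: "ip (flip f) g = ip f (flip g)"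
  unfolding ip_def supp_flip by (rule sum.cong) (auto simp: flip_def)

lemma Hshift_core: "f \<in> core D \<Longrightarrow> Hshift l1 l2 D t f \<in> core D"
  unfolding Hshift_def by (intro core_add_scale Hcore_core)

lemma Hshift_add_scale:
  assumes "f \<in> core D" "g \<in> core D"
  shows "Hshift l1 l2 D t (\<lambda>S. f S + a * g S) S = Hshift l1 l2 D t f S + a * Hshift l1 l2 D t g S"
  unfolding Hshift_def Hcore_add_scale[OF assms] by (simp add: algebra_simps)

lemma core_finite_supp: "f \<in> core D \<Longrightarrow> finite (supp f)"
  by (simp add: core_iff)

lemma ip_self: "ip f f = (\<Sum>S\<in>supp f. (cmod (f S))\<^sup>2)"
  unfolding ip_def by (rule sum.cong) (simp, metis Re_complex_of_real complex_norm_square mult.commute)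

lemma ip_self_nonneg: "ip f f \<ge> 0"
  unfolding ip_self by (rule sum_nonneg) simp

lemma ip_square_expand:
  assumes "f \<in> core D" "g \<in> core D"
  shows "ip (\<lambda>S. f S + of_real a * g S) (\<lambda>S. f S + of_real a * g S) = ip f f + 2 * a * ip f g + a\<^sup>2 * ip g g"
proof -
  let ?h = "\<lambda>S. f S + of_real a * g S"
  note fin = core_finite_supp[OF assms(1)] core_finite_supp[OF assms(2)]
    core_finite_supp[OF core_add_scale[OF assms, of "of_real a"]]
  have "ip ?h ?h = ip ?h f + a * ip ?h g"
    by (rule ip_add_scale_right)
  also have "ip ?h f = ip f f + a * ip f g"
    using ip_commute[OF fin(3,1)] ip_add_scale_right[of f f a g] by simp
  also have "ip ?h g = ip f g + a * ip g g"
    using ip_commute[OF fin(3,2)] ip_add_scale_right[of g f a g] ip_commute[OF fin(1,2)] by simp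
  finally show ?thesis
    by (simp add: algebra_simps power2_eq_square)
qed

lemma energy_expand:
  assumes "f \<in> core D" "g \<in> core D"
  shows "ip (\<lambda>S. f S + of_real a * g S) (Hcore l1 l2 D (\<lambda>S. f S + of_real a * g S))
    = ip f (Hcore l1 l2 D f) + 2 * a * ip g (Hcore l1 l2 D f) + a\<^sup>2 * ip g (Hcore l1 l2 D g)"
proof -
  let ?h = "\<lambda>S. f S + of_real a * g S"
  let ?H = "Hcore l1 l2 D"
  note h = core_add_scale[OF assms, of "of_real a"]
  have H: "?H ?h = (\<lambda>S. ?H f S + of_real a * ?H g S)"
    using Hcore_add_scale[OF assms] by auto
  have "ip ?h (?H ?h) = ip ?h (?H f) + a * ip ?h (?H g)"
    unfolding H by (rule ip_add_scale_right)
  also have "ip ?h (?H f) = ip f (?H f) + a * ip g (?H f)"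
    unfolding ip_Hcore_commute[OF h assms(1)] H ip_add_scale_right
    using ip_Hcore_commute[OF assms] by simp
  also have "ip ?h (?H g) = ip g (?H f) + a * ip g (?H g)"
    unfolding ip_Hcore_commute[OF h assms(2)] H ip_add_scale_right by simp
  finally show ?thesis
    by (simp add: algebra_simps power2_eq_square)
qed

text \<open>H annihilates the vacuum, and by symmetry the vacuum row of its matrix vanishes too.
  Hence the sign flip leaves H f unchanged.\<close>

lemma Hcore_empty:
  assumes "f \<in> core D"
  shows "Hcore l1 l2 D f {} = 0"
  unfolding Hcore_def supp_def[symmetric]
proof (rule sum.neutral, rule ballI)
  fix S assume "S \<in> supp f"
  then have "finite S" using assms by (auto simp: core_iff configs_def)
  then show "Hmat l1 l2 D {} S * f S = 0"
    using Hmat_sym[of S "{}" l1 l2 D] by (simp add: Hmat_vacuum)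
qed

text \<open>Let v be the vacuum weight of f and e the remaining weight. The form equals the energy
  minus t (e - v), and the energy is at least \<delta> e because every other configuration has a
  particle. This leaves (\<delta> - t) e + t v.\<close>

lemma flip_Hshift_lower:
  assumes f: "f \<in> core D" and gap: "\<delta> * number f \<le> ip f (Hcore l1 l2 D f)" and t: "0 < t" "t < \<delta>"
  shows "min t (\<delta> - t) * ip f f \<le> ip f (flip (Hshift l1 l2 D t f))"
proof -
  have fin: "finite (supp f)" using f by (rule core_finite_supp)
  define v where "v = (cmod (f {}))\<^sup>2"
  define e where "e = (\<Sum>S\<in>supp f - {{}}. (cmod (f S))\<^sup>2)"
  have v0: "v \<ge> 0" and e0: "e \<ge> 0"
    by (auto simp: v_def e_def intro: sum_nonneg)
  have split: "(\<Sum>S\<in>supp f. F S) = F {} + (\<Sum>S\<in>supp f - {{}}. F S)" if "f {} = 0 \<Longrightarrow> F {} = 0" for F :: "config \<Rightarrow> real"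
    using that fin by (cases "{} \<in> supp f") (auto simp: sum.remove supp_def)
  have ff: "ip f f = v + e"
    unfolding ip_self v_def e_def by (rule split) simp
  have sq: "Re (cnj z * z) = (cmod z)\<^sup>2" for z
    by (metis Re_complex_of_real complex_norm_square mult.commute)
  have "ip f (flip f) = Re (cnj (f {}) * (- f {})) + (\<Sum>S\<in>supp f - {{}}. Re (cnj (f S) * flip f S))"
    unfolding ip_def by (subst split) (auto simp: flip_def)
  also have "Re (cnj (f {}) * (- f {})) = - v"
    using sq[of "f {}"] by (simp add: v_def)
  also have "(\<Sum>S\<in>supp f - {{}}. Re (cnj (f S) * flip f S)) = e"
    unfolding e_def
  proof (rule sum.cong)
    fix S assume "S \<in> supp f - {{}}"
    then have "flip f S = f S"
      by (simp add: flip_def)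
    then show "Re (cnj (f S) * flip f S) = (cmod (f S))\<^sup>2"
      by (simp only: sq)
  qed simp
  finally have fl: "ip f (flip f) = e - v" by simp
  have "e \<le> number f"
  proof -
    have "e \<le> (\<Sum>S\<in>supp f - {{}}. real (card S) * (cmod (f S))\<^sup>2)"
      unfolding e_def
    proof (rule sum_mono)
      fix S assume "S \<in> supp f - {{}}"
      then have "finite S" "S \<noteq> {}"
        using f by (auto simp: core_iff configs_def)
      then have "1 \<le> real (card S)"
        by (simp add: Suc_le_eq card_gt_0_iff)
      then show "(cmod (f S))\<^sup>2 \<le> real (card S) * (cmod (f S))\<^sup>2"
        by (simp add: mult_le_cancel_right1)
    qed
    also have "\<dots> \<le> number f"
      unfolding number_def by (rule sum_mono2) (use fin in auto)
    finally show ?thesis .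
  qed
  then have E: "\<delta> * e \<le> ip f (Hcore l1 l2 D f)"
    using gap t mult_left_mono[of e "number f" \<delta>] by linarith
  have "flip (Hshift l1 l2 D t f) = (\<lambda>S. Hcore l1 l2 D f S + of_real (- t) * flip f S)"
    using Hcore_empty[OF f] by (auto simp: flip_def Hshift_def)
  then have "ip f (flip (Hshift l1 l2 D t f)) = ip f (Hcore l1 l2 D f) - t * ip f (flip f)"
    by (simp add: ip_add_scale_right[of f _ "- t"] del: of_real_minus)
  then have "ip f (flip (Hshift l1 l2 D t f)) \<ge> (\<delta> - t) * e + t * v"
    using E by (simp add: fl algebra_simps)
  moreover have "min t (\<delta> - t) * e \<le> (\<delta> - t) * e" "min t (\<delta> - t) * v \<le> t * v"
    using v0 e0 by (auto intro!: mult_right_mono)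
  ultimately show ?thesis
    unfolding ff by (simp add: algebra_simps)
qed

lemma Hshift_lower:
  assumes f: "f \<in> core D" and gap: "\<delta> * number f \<le> ip f (Hcore l1 l2 D f)" and t: "0 < t" "t < \<delta>"
  shows "min t (\<delta> - t) * l2norm f \<le> l2norm (Hshift l1 l2 D t f)"
proof -
  define c where "c = min t (\<delta> - t)"
  define g where "g = Hshift l1 l2 D t f"
  have c: "c > 0" using t by (simp add: c_def)
  have g: "g \<in> core D" unfolding g_def using f by (rule Hshift_core)
  \<comment> \<open>Expanding the square of g - c \<open>flip f\<close> turns coercivity into a norm
    bound; it stands in for Cauchy-Schwarz.\<close>
  have "0 \<le> ip (\<lambda>S. g S + of_real (- c) * flip f S) (\<lambda>S. g S + of_real (- c) * flip f S)"
    by (rule ip_self_nonneg)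
  also have "\<dots> = ip g g - 2 * c * ip g (flip f) + c\<^sup>2 * ip (flip f) (flip f)"
    using ip_square_expand[OF g flip_core[OF f], of "- c"] by simp
  also have "ip (flip f) (flip f) = ip f f"
    by (simp add: ip_flip)
  also have "ip g (flip f) = ip f (flip g)"
    using ip_commute[of g "flip f"] core_finite_supp[OF f] core_finite_supp[OF g] by (simp add: ip_flip)
  finally have "2 * c * ip f (flip g) \<le> ip g g + c\<^sup>2 * ip f f"
    by linarith
  moreover have "2 * c * (c * ip f f) \<le> 2 * c * ip f (flip g)"
    using flip_Hshift_lower[OF f gap t] c by (intro mult_left_mono) (auto simp: c_def g_def)
  ultimately have "c\<^sup>2 * ip f f \<le> ip g g"
    by (simp add: power2_eq_square)
  then have "sqrt (c\<^sup>2 * ip f f) \<le> sqrt (ip g g)"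
    by simp
  then show ?thesis
    using c core_finite_supp[OF f] core_finite_supp[OF g]
    by (simp add: square_summable_finite(2) real_sqrt_mult c_def[symmetric] g_def[symmetric])
qed

section \<open>Sectors of bounded particle number\<close>

definition coreN :: "site set \<Rightarrow> nat \<Rightarrow> vec set" where
  "coreN D N = {f \<in> core D. \<forall>S\<in>supp f. card S \<le> N}"

lemma coreN_add_scale:
  assumes "f \<in> coreN D N" "g \<in> coreN D N"
  shows "(\<lambda>S. f S + a * g S) \<in> coreN D N"
proof -
  have "supp (\<lambda>S. f S + a * g S) \<subseteq> supp f \<union> supp g"
    by (auto simp: supp_def)
  then show ?thesis
    using assms core_add_scale[of f D g a] by (auto simp: coreN_def)
qed

lemma coreN_Hcore:
  assumes "f \<in> coreN D N"
  shows "Hcore l1 l2 D f \<in> coreN D N"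
proof -
  have "card T \<le> N" if "T \<in> supp (Hcore l1 l2 D f)" for T
    using that
  proof (rule Hcore_nonzeroE)
    fix S assume S: "S \<in> supp f" "Hmat l1 l2 D T S \<noteq> 0"
    then have "finite S" "card S \<le> N"
      using assms by (auto simp: coreN_def core_iff configs_def)
    then show ?thesis
      using Hmat_card[OF S(2)] by simp
  qed
  then show ?thesis
    using assms by (auto simp: coreN_def Hcore_core)
qed

lemma coreN_flip_Hshift:
  assumes "f \<in> coreN D N"
  shows "flip (Hshift l1 l2 D t f) \<in> coreN D N"
proof -
  have "Hshift l1 l2 D t f \<in> coreN D N"
    unfolding Hshift_def using assms by (intro coreN_add_scale coreN_Hcore)
  then show ?thesis
    by (simp add: coreN_def flip_core)
qed

text \<open>The bound 4 N is raised by 1 so that the constant stays positive for N = 0 and can be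
  divided by.\<close>

lemma energy_le_coreN:
  assumes "f \<in> coreN D N"
  shows "ip f (Hcore l1 l2 D f) \<le> (4 * real N + 1) * ip f f"
proof -
  have "number f \<le> (\<Sum>S\<in>supp f. real N * (cmod (f S))\<^sup>2)"
    unfolding number_def by (rule sum_mono) (use assms in \<open>auto simp: coreN_def intro: mult_right_mono\<close>)
  then have "number f \<le> real N * ip f f"
    by (simp add: ip_self sum_distrib_left)
  moreover have "ip f (Hcore l1 l2 D f) \<le> 4 * number f"
    using assms by (intro energy_le_number) (simp add: coreN_def)
  ultimately show ?thesis
    using ip_self_nonneg[of f] by (simp add: algebra_simps)
qed

text \<open>Passes from the form bounds 0 \<le> H \<le> M to the norm bound M, which rests on the
  symmetry of H and on the sector being invariant, so that the form bound also applies to H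
  f.\<close>

lemma Hcore_bounded_coreN:
  assumes f: "f \<in> coreN D N"
  shows "ip (Hcore l1 l2 D f) (Hcore l1 l2 D f) \<le> (4 * real N + 1)\<^sup>2 * ip f f"
proof -
  define M where "M = 4 * real N + 1"
  define g where "g = Hcore l1 l2 D f"
  have M: "M > 0" by (simp add: M_def add_nonneg_pos)
  have g: "g \<in> coreN D N" unfolding g_def using f by (rule coreN_Hcore)
  have c: "f \<in> core D" "g \<in> core D" using f g by (auto simp: coreN_def)
  \<comment> \<open>the energy of \<open>f - H f / M\<close> is nonnegative\<close>
  have "0 \<le> ip f (Hcore l1 l2 D f) + 2 * (- 1 / M) * ip g (Hcore l1 l2 D f) + (- 1 / M)\<^sup>2 * ip g (Hcore l1 l2 D g)"
    using energy_nonneg[OF core_add_scale[OF c, of "of_real (- 1 / M)"], of l1 l2]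
    unfolding energy_expand[OF c, of "- 1 / M"] .
  also have "\<dots> \<le> M * ip f f + 2 * (- 1 / M) * ip g g + (- 1 / M)\<^sup>2 * (M * ip g g)"
  proof -
    have "(- 1 / M)\<^sup>2 * ip g (Hcore l1 l2 D g) \<le> (- 1 / M)\<^sup>2 * (M * ip g g)"
      using energy_le_coreN[OF g, of l1 l2] unfolding M_def[symmetric] by (rule mult_left_mono) simp
    then show ?thesis
      using energy_le_coreN[OF f, of l1 l2] unfolding M_def[symmetric] g_def[symmetric] by linarith
  qed
  also have "\<dots> = M * ip f f - ip g g / M"
    using M by (simp add: field_simps power2_eq_square)
  finally show ?thesis
    unfolding M_def[symmetric] g_def[symmetric] using M by (simp add: field_simps power2_eq_square)
qed

lemma Hshift_bounded_coreN:
  assumes f: "f \<in> coreN D N" and "t > 0"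
  shows "ip (Hshift l1 l2 D t f) (Hshift l1 l2 D t f) \<le> ((4 * real N + 1)\<^sup>2 + t\<^sup>2) * ip f f"
proof -
  have c: "f \<in> core D" using f by (simp add: coreN_def)
  note h = Hcore_core[OF c, of l1 l2]
  have "ip (Hshift l1 l2 D t f) (Hshift l1 l2 D t f)
      = ip (Hcore l1 l2 D f) (Hcore l1 l2 D f) - 2 * t * ip f (Hcore l1 l2 D f) + t\<^sup>2 * ip f f"
    unfolding Hshift_def using ip_square_expand[OF h c, of "- t"]
      ip_commute[OF core_finite_supp[OF h] core_finite_supp[OF c]] by simp
  moreover have "2 * t * ip f (Hcore l1 l2 D f) \<ge> 0"
    using energy_nonneg[OF c] \<open>t > 0\<close> by simp
  ultimately show ?thesis
    using Hcore_bounded_coreN[OF f, of l1 l2] by (simp add: algebra_simps)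
qed

text \<open>With A bounded and coercive, the map r \<mapsto> r - \<kappa> A r contracts squared
  norms by 1 - 2 \<kappa> c + \<kappa>^2 K. Adding \<kappa> times the residual to the approximate
  solution applies this map to the residual.\<close>

lemma richardson:
  assumes gap: "\<And>f. f \<in> core D \<Longrightarrow> \<delta> * number f \<le> ip f (Hcore l1 l2 D f)" and t: "0 < t" "t < \<delta>"
  obtains \<rho> where "0 \<le> \<rho>" "\<rho> < 1"
    "\<And>\<phi> n. \<phi> \<in> coreN D N \<Longrightarrow> \<exists>f\<in>coreN D N.
       ip (\<lambda>S. \<phi> S - flip (Hshift l1 l2 D t f) S) (\<lambda>S. \<phi> S - flip (Hshift l1 l2 D t f) S) \<le> \<rho> ^ n * ip \<phi> \<phi>"
proof -
  define A where "A f = flip (Hshift l1 l2 D t f)" for f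
  define c where "c = min t (\<delta> - t)"
  \<comment> \<open>Bounds the squared norm of A on the sector. The summand \<open>c\<^sup>2\<close>
    ensures that \<open>c\<^sup>2 / K\<close> is at most 1, so that \<rho> is nonnegative.\<close>
  define K where "K = (4 * real N + 1)\<^sup>2 + t\<^sup>2 + c\<^sup>2"
  \<comment> \<open>The minimiser of 1 - 2 \<kappa> c + \<kappa>^2 K; the minimum is \<rho>.\<close>
  define \<kappa> where "\<kappa> = c / K"
  define \<rho> where "\<rho> = 1 - c\<^sup>2 / K"
  have c: "c > 0" using t by (simp add: c_def)
  have K: "K > 0" "c\<^sup>2 \<le> K" using c by (auto simp: K_def intro!: add_nonneg_pos)
  have AN: "A f \<in> coreN D N" if "f \<in> coreN D N" for f
    unfolding A_def using that by (rule coreN_flip_Hshift)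
  have contract: "ip (\<lambda>S. r S + of_real (- \<kappa>) * A r S) (\<lambda>S. r S + of_real (- \<kappa>) * A r S) \<le> \<rho> * ip r r"
    if r: "r \<in> coreN D N" for r
  proof -
    have rc: "r \<in> core D" and ac: "A r \<in> core D"
      using r AN[OF r] by (auto simp: coreN_def)
    have "ip (A r) (A r) \<le> K * ip r r"
      using Hshift_bounded_coreN[OF r t(1), of l1 l2] ip_self_nonneg[of r]
      by (simp add: A_def ip_flip K_def algebra_simps add_increasing)
    then have "\<kappa>\<^sup>2 * ip (A r) (A r) \<le> \<kappa>\<^sup>2 * (K * ip r r)"
      by (rule mult_left_mono) simp
    moreover have "2 * \<kappa> * (c * ip r r) \<le> 2 * \<kappa> * ip r (A r)"
      using flip_Hshift_lower[OF rc gap[OF rc] t] c K by (intro mult_left_mono) (auto simp: A_def c_def \<kappa>_def)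
    moreover have "\<kappa>\<^sup>2 * (K * ip r r) - 2 * \<kappa> * (c * ip r r) = (\<rho> - 1) * ip r r"
      using K by (simp add: \<kappa>_def \<rho>_def field_simps power2_eq_square)
    ultimately show ?thesis
      unfolding ip_square_expand[OF rc ac] by (simp add: algebra_simps)
  qed
  have \<rho>: "0 \<le> \<rho>" "\<rho> < 1"
    using K c by (auto simp: \<rho>_def)
  show thesis
  proof
    show "0 \<le> \<rho>" "\<rho> < 1" by (fact \<rho>)+
    fix \<phi> n assume \<phi>: "\<phi> \<in> coreN D N"
    \<comment> \<open>That the residual stays in the sector is carried through the induction, since
      the contraction bound holds only there.\<close>
    have "\<exists>f\<in>coreN D N. (\<lambda>S. \<phi> S - A f S) \<in> coreN D N \<and>
       ip (\<lambda>S. \<phi> S - A f S) (\<lambda>S. \<phi> S - A f S) \<le> \<rho> ^ n * ip \<phi> \<phi>"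
    proof (induction n)
      case 0
      have "(\<lambda>S. 0) \<in> coreN D N"
        by (auto simp: coreN_def core_def supp_def)
      moreover have "A (\<lambda>S. 0) S = 0" for S
        by (simp add: A_def flip_def Hshift_def Hcore_def)
      ultimately show ?case
        using \<phi> by (intro bexI[of _ "\<lambda>S. 0"]) simp_all
    next
      case (Suc n)
      then obtain f where f: "f \<in> coreN D N" and r: "(\<lambda>S. \<phi> S - A f S) \<in> coreN D N"
        and b: "ip (\<lambda>S. \<phi> S - A f S) (\<lambda>S. \<phi> S - A f S) \<le> \<rho> ^ n * ip \<phi> \<phi>"
        by blast
      define r where "r = (\<lambda>S. \<phi> S - A f S)"
      have rN: "r \<in> coreN D N" using r by (simp add: r_def)
      define f' where "f' = (\<lambda>S. f S + of_real \<kappa> * r S)"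
      have f': "f' \<in> coreN D N"
        unfolding f'_def using f rN by (rule coreN_add_scale)
      have "A f' S = A f S + of_real \<kappa> * A r S" for S
        unfolding f'_def A_def flip_def
        using Hshift_add_scale[of f D r l1 l2 t "of_real \<kappa>"] f rN by (simp add: coreN_def)
      then have eq: "(\<lambda>S. \<phi> S - A f' S) = (\<lambda>S. r S + of_real (- \<kappa>) * A r S)"
        by (auto simp: r_def)
      have "(\<lambda>S. \<phi> S - A f' S) \<in> coreN D N"
        unfolding eq using rN AN[OF rN] by (rule coreN_add_scale)
      moreover have "ip (\<lambda>S. \<phi> S - A f' S) (\<lambda>S. \<phi> S - A f' S) \<le> \<rho> ^ Suc n * ip \<phi> \<phi>"
        unfolding eq using contract[OF rN] mult_left_mono[OF b \<rho>(1)] by (simp add: r_def mult.assoc)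
      ultimately show ?case
        using f' by blast
    qed
    then show "\<exists>f\<in>coreN D N.
       ip (\<lambda>S. \<phi> S - flip (Hshift l1 l2 D t f) S) (\<lambda>S. \<phi> S - flip (Hshift l1 l2 D t f) S) \<le> \<rho> ^ n * ip \<phi> \<phi>"
      unfolding A_def by blast
  qed
qed

lemma Hshift_range_dense_core:
  assumes gap: "\<And>f. f \<in> core D \<Longrightarrow> \<delta> * number f \<le> ip f (Hcore l1 l2 D f)" and t: "0 < t" "t < \<delta>"
    and \<phi>: "\<phi> \<in> core D" and "e > 0"
  obtains f where "f \<in> core D" "l2norm (\<lambda>S. \<phi> S - Hshift l1 l2 D t f S) \<le> e"
proof -
  \<comment> \<open>The 0 keeps the maximum defined when \<phi> has empty support.\<close>
  define N where "N = Max (insert 0 (card ` supp \<phi>))"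
  have "flip \<phi> \<in> coreN D N"
    using \<phi> by (auto simp: coreN_def flip_core N_def core_finite_supp)
  obtain \<rho> where \<rho>: "0 \<le> \<rho>" "\<rho> < 1"
    "\<And>\<phi> n. \<phi> \<in> coreN D N \<Longrightarrow> \<exists>f\<in>coreN D N.
       ip (\<lambda>S. \<phi> S - flip (Hshift l1 l2 D t f) S) (\<lambda>S. \<phi> S - flip (Hshift l1 l2 D t f) S) \<le> \<rho> ^ n * ip \<phi> \<phi>"
    using richardson[OF gap t] by blast
  have "(\<lambda>n. \<rho> ^ n * ip \<phi> \<phi>) \<longlonglongrightarrow> 0 * ip \<phi> \<phi>"
    using \<rho> by (intro tendsto_mult LIMSEQ_realpow_zero tendsto_const)
  then have "\<forall>\<^sub>F n in sequentially. \<rho> ^ n * ip \<phi> \<phi> < e\<^sup>2"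
    using \<open>e > 0\<close> by (intro order_tendstoD) auto
  then obtain n where n: "\<rho> ^ n * ip \<phi> \<phi> < e\<^sup>2"
    by (auto simp: eventually_sequentially)
  obtain f where f: "f \<in> coreN D N"
    "ip (\<lambda>S. flip \<phi> S - flip (Hshift l1 l2 D t f) S) (\<lambda>S. flip \<phi> S - flip (Hshift l1 l2 D t f) S) \<le> \<rho> ^ n * ip (flip \<phi>) (flip \<phi>)"
    using \<rho>(3)[OF \<open>flip \<phi> \<in> coreN D N\<close>] by blast
  define r where "r = (\<lambda>S. \<phi> S - Hshift l1 l2 D t f S)"
  have fc: "f \<in> core D" using f by (simp add: coreN_def)
  have "r \<in> core D"
    using core_add_scale[OF \<phi> Hshift_core[OF fc, of l1 l2 t], of "- 1"] by (simp add: r_def)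
  \<comment> \<open>The iteration was run for the flipped target; flipping is isometric, so the
    residual for \<phi> itself is equally small.\<close>
  have "(\<lambda>S. flip \<phi> S - flip (Hshift l1 l2 D t f) S) = flip r"
    by (auto simp: flip_def r_def)
  then have "ip r r \<le> e\<^sup>2"
    using f(2) n by (simp add: ip_flip)
  then have "l2norm r \<le> e"
    unfolding square_summable_finite(2)[OF core_finite_supp[OF \<open>r \<in> core D\<close>]]
    using \<open>e > 0\<close> by (intro real_le_lsqrt) auto
  then show thesis
    using that[OF fc] by (simp add: r_def)
qed

section \<open>The spectrum of the closure\<close>

lemma l2space_iff: "f \<in> l2space D \<longleftrightarrow> supp f \<subseteq> configs D \<and> square_summable f"
  by (auto simp: l2space_def supp_def square_summable_def)

lemma core_l2space: "f \<in> core D \<Longrightarrow> f \<in> l2space D"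
  by (simp add: core_iff l2space_iff square_summable_finite(1))

lemma l2space_add_scale:
  assumes "f \<in> l2space D" "g \<in> l2space D"
  shows "(\<lambda>S. f S + a * g S) \<in> l2space D"
proof -
  have "supp (\<lambda>S. f S + a * g S) \<subseteq> supp f \<union> supp g"
    by (auto simp: supp_def)
  moreover have "square_summable (\<lambda>S. f S + a * g S)"
    by (rule l2norm_linear(1)) (use assms in \<open>auto simp: l2space_iff\<close>)
  ultimately show ?thesis
    using assms by (auto simp: l2space_iff)
qed

lemma l2space_diff:
  assumes "f \<in> l2space D" "g \<in> l2space D"
  shows "(\<lambda>S. f S - g S) \<in> l2space D" "l2norm (\<lambda>S. f S - g S) \<le> l2norm f + l2norm g"
  using l2space_add_scale[OF assms, of "- 1"] l2norm_linear(2)[of f g "\<lambda>S. f S - g S" "- 1"] assms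
  by (simp_all add: l2space_iff)

lemma l2norm_diff_commute: "l2norm (\<lambda>S. f S - g S) = l2norm (\<lambda>S. g S - f S)"
  by (simp add: l2norm_def norm_minus_commute)

lemma l2norm_triangle:
  assumes "f \<in> l2space D" "g \<in> l2space D" "h \<in> l2space D"
  shows "l2norm (\<lambda>S. f S - h S) \<le> l2norm (\<lambda>S. f S - g S) + l2norm (\<lambda>S. g S - h S)"
  using l2norm_linear(2)[of "\<lambda>S. f S - g S" "\<lambda>S. g S - h S" "\<lambda>S. f S - h S" 1]
    l2space_diff(1)[OF assms(1,2)] l2space_diff(1)[OF assms(2,3)]
  by (simp add: l2space_iff)

text \<open>Lets the lower bound be applied to the difference of two solutions, which gives
  uniqueness.\<close>

lemma Hgraph_diff:
  assumes "(\<psi>, w) \<in> Hgraph l1 l2 D" "(\<psi>', w') \<in> Hgraph l1 l2 D"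
  shows "(\<lambda>S. \<psi> S - \<psi>' S, \<lambda>S. w S - w' S) \<in> Hgraph l1 l2 D"
proof -
  obtain f where f: "\<And>n. f n \<in> core D" "(\<lambda>n. l2norm (\<lambda>S. f n S - \<psi> S)) \<longlonglongrightarrow> 0"
    "(\<lambda>n. l2norm (\<lambda>S. Hcore l1 l2 D (f n) S - w S)) \<longlonglongrightarrow> 0" and p: "\<psi> \<in> l2space D" "w \<in> l2space D"
    using assms(1) by (auto simp: Hgraph_def)
  obtain g where g: "\<And>n. g n \<in> core D" "(\<lambda>n. l2norm (\<lambda>S. g n S - \<psi>' S)) \<longlonglongrightarrow> 0"
    "(\<lambda>n. l2norm (\<lambda>S. Hcore l1 l2 D (g n) S - w' S)) \<longlonglongrightarrow> 0" and p': "\<psi>' \<in> l2space D" "w' \<in> l2space D"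
    using assms(2) by (auto simp: Hgraph_def)
  have le: "l2norm (\<lambda>S. (a S - b S) - (c S - d S)) \<le> l2norm (\<lambda>S. a S - c S) + l2norm (\<lambda>S. b S - d S)"
    if "a \<in> l2space D" "b \<in> l2space D" "c \<in> l2space D" "d \<in> l2space D" for a b c d
    using l2space_diff(2)[OF l2space_diff(1)[OF that(1,3)] l2space_diff(1)[OF that(2,4)]]
    by (simp add: algebra_simps)
  define h where "h n = (\<lambda>S. f n S - g n S)" for n
  have h: "h n \<in> core D" for n
    using core_add_scale[OF f(1) g(1), of n "- 1" n] by (simp add: h_def)
  have H: "Hcore l1 l2 D (h n) = (\<lambda>S. Hcore l1 l2 D (f n) S - Hcore l1 l2 D (g n) S)" for n
    using Hcore_add_scale[OF f(1) g(1), of l1 l2 n "- 1" n] by (auto simp: h_def)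
  have 1: "(\<lambda>n. l2norm (\<lambda>S. h n S - (\<psi> S - \<psi>' S))) \<longlonglongrightarrow> 0"
  proof (rule tendsto_sandwich[of "\<lambda>_. 0"])
    show "(\<lambda>n. l2norm (\<lambda>S. f n S - \<psi> S) + l2norm (\<lambda>S. g n S - \<psi>' S)) \<longlonglongrightarrow> 0"
      using tendsto_add[OF f(2) g(2)] by simp
    show "\<forall>\<^sub>F n in sequentially. l2norm (\<lambda>S. h n S - (\<psi> S - \<psi>' S))
        \<le> l2norm (\<lambda>S. f n S - \<psi> S) + l2norm (\<lambda>S. g n S - \<psi>' S)"
      unfolding h_def by (intro always_eventually allI le core_l2space f g p p')
  qed (auto simp: l2norm_nonneg)
  have 2: "(\<lambda>n. l2norm (\<lambda>S. Hcore l1 l2 D (h n) S - (w S - w' S))) \<longlonglongrightarrow> 0"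
  proof (rule tendsto_sandwich[of "\<lambda>_. 0"])
    show "(\<lambda>n. l2norm (\<lambda>S. Hcore l1 l2 D (f n) S - w S) + l2norm (\<lambda>S. Hcore l1 l2 D (g n) S - w' S)) \<longlonglongrightarrow> 0"
      using tendsto_add[OF f(3) g(3)] by simp
    show "\<forall>\<^sub>F n in sequentially. l2norm (\<lambda>S. Hcore l1 l2 D (h n) S - (w S - w' S))
        \<le> l2norm (\<lambda>S. Hcore l1 l2 D (f n) S - w S) + l2norm (\<lambda>S. Hcore l1 l2 D (g n) S - w' S)"
      unfolding H by (intro always_eventually allI le core_l2space Hcore_core f g p p')
  qed (auto simp: l2norm_nonneg)
  show ?thesis
    unfolding Hgraph_def using h 1 2 l2space_diff(1)[OF p(1) p'(1)] l2space_diff(1)[OF p(2) p'(2)] by auto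
qed

lemma Hgraph_lower:
  assumes gap: "\<And>f. f \<in> core D \<Longrightarrow> \<delta> * number f \<le> ip f (Hcore l1 l2 D f)" and t: "0 < t" "t < \<delta>"
    and G: "(\<psi>, w) \<in> Hgraph l1 l2 D"
  shows "min t (\<delta> - t) * l2norm \<psi> \<le> l2norm (\<lambda>S. w S - of_real t * \<psi> S)"
proof -
  define c where "c = min t (\<delta> - t)"
  have c: "c > 0" using t by (simp add: c_def)
  obtain f where f: "\<And>n. f n \<in> core D" "(\<lambda>n. l2norm (\<lambda>S. f n S - \<psi> S)) \<longlonglongrightarrow> 0"
    "(\<lambda>n. l2norm (\<lambda>S. Hcore l1 l2 D (f n) S - w S)) \<longlonglongrightarrow> 0" and p: "\<psi> \<in> l2space D" "w \<in> l2space D"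
    using G by (auto simp: Hgraph_def)
  let ?v = "\<lambda>S. w S - of_real t * \<psi> S"
  have v: "?v \<in> l2space D"
    using l2space_add_scale[OF p(2,1), of "- of_real t"] by simp
  \<comment> \<open>The lower bound for \<open>f n\<close>, with the cost of replacing
    \<open>f n\<close> by \<psi>: c from the left-hand norm, t from the shift, and the last term
    from replacing H \<open>f n\<close> by w.\<close>
  have "c * l2norm \<psi> - l2norm ?v \<le> (c + t) * l2norm (\<lambda>S. f n S - \<psi> S) + l2norm (\<lambda>S. Hcore l1 l2 D (f n) S - w S)" for n
  proof -
    note fl = core_l2space[OF f(1)[of n]] and Hl = core_l2space[OF Hcore_core[OF f(1)[of n]], of l1 l2]
    note d1 = l2space_diff(1)[OF fl p(1)] and d2 = l2space_diff(1)[OF Hl p(2)]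
    let ?u = "\<lambda>S. (Hcore l1 l2 D (f n) S - w S) + of_real (- t) * (f n S - \<psi> S)"
    have "l2norm \<psi> \<le> l2norm (f n) + l2norm (\<lambda>S. f n S - \<psi> S)"
      using l2norm_linear(2)[of "f n" "\<lambda>S. f n S - \<psi> S" \<psi> "- 1"] fl d1 by (simp add: l2space_iff)
    then have "c * l2norm \<psi> \<le> c * l2norm (f n) + c * l2norm (\<lambda>S. f n S - \<psi> S)"
      using c by (simp add: distrib_left[symmetric])
    also have "c * l2norm (f n) \<le> l2norm (Hshift l1 l2 D t (f n))"
      unfolding c_def by (rule Hshift_lower[OF f(1) gap[OF f(1)] t])
    also have "l2norm (Hshift l1 l2 D t (f n)) \<le> l2norm ?v + cmod 1 * l2norm ?u"
    proof (rule l2norm_linear(2))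
      show "square_summable ?u"
        using l2space_add_scale[OF d2 d1, of "of_real (- t)"] by (simp only: l2space_iff)
    qed (use v in \<open>auto simp: l2space_iff Hshift_def algebra_simps\<close>)
    also have "l2norm ?u \<le> l2norm (\<lambda>S. Hcore l1 l2 D (f n) S - w S) + cmod (of_real (- t)) * l2norm (\<lambda>S. f n S - \<psi> S)"
      by (rule l2norm_linear(2)) (use d1 d2 in \<open>auto simp: l2space_iff\<close>)
    finally show ?thesis
      using t by (simp add: algebra_simps)
  qed
  moreover have "(\<lambda>n. (c + t) * l2norm (\<lambda>S. f n S - \<psi> S) + l2norm (\<lambda>S. Hcore l1 l2 D (f n) S - w S)) \<longlonglongrightarrow> (c + t) * 0 + 0"
    by (intro tendsto_intros f)
  ultimately have "c * l2norm \<psi> - l2norm ?v \<le> (c + t) * 0 + 0"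
    by (intro LIMSEQ_le_const) auto
  then show ?thesis by (simp add: c_def)
qed

text \<open>Core vectors \<open>f n\<close> with (H - t) \<open>f n\<close> tending to \<phi> form a
  Cauchy sequence by the lower bound. With \<psi> their limit, H \<open>f n\<close> tends to \<phi>
  + t \<psi>, which places the pair in the graph of the closure.\<close>

lemma Hgraph_solve:
  assumes gap: "\<And>f. f \<in> core D \<Longrightarrow> \<delta> * number f \<le> ip f (Hcore l1 l2 D f)" and t: "0 < t" "t < \<delta>"
    and \<phi>: "\<phi> \<in> l2space D"
  obtains \<psi> where "(\<psi>, \<lambda>S. \<phi> S + of_real t * \<psi> S) \<in> Hgraph l1 l2 D"
proof -
  define c where "c = min t (\<delta> - t)"
  have c: "c > 0" using t by (simp add: c_def)
  \<comment> \<open>Half of the error is spent on replacing \<phi> by a core vector, half on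
    approximating that vector from the range.\<close>
  have "\<exists>f. f \<in> core D \<and> l2norm (\<lambda>S. \<phi> S - Hshift l1 l2 D t f S) \<le> inverse (real (Suc n))" for n
  proof -
    let ?e = "inverse (real (Suc n)) / 2"
    have e: "?e > 0" by simp
    obtain g where g: "g \<in> core D" "l2norm (\<lambda>S. \<phi> S - g S) \<le> ?e"
      using core_dense[OF \<phi> e] .
    obtain f where f: "f \<in> core D" "l2norm (\<lambda>S. g S - Hshift l1 l2 D t f S) \<le> ?e"
      using Hshift_range_dense_core[OF gap t g(1) e] by blast
    have "l2norm (\<lambda>S. \<phi> S - Hshift l1 l2 D t f S) \<le> ?e + ?e"
      using l2norm_triangle[OF \<phi> core_l2space[OF g(1)] core_l2space[OF Hshift_core[OF f(1)]], of l1 l2 t] f(2) g(2)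
      by linarith
    then show ?thesis using f(1) by auto
  qed
  then obtain f where f: "\<And>n. f n \<in> core D"
    and lim: "\<And>n. l2norm (\<lambda>S. \<phi> S - Hshift l1 l2 D t (f n) S) \<le> inverse (real (Suc n))"
    by metis
  have sh: "Hshift l1 l2 D t (f n) \<in> l2space D" for n
    by (intro core_l2space Hshift_core f)
  have diff: "c * l2norm (\<lambda>S. f m S - f n S) \<le> inverse (real (Suc m)) + inverse (real (Suc n))" for m n
  proof -
    have d: "(\<lambda>S. f m S - f n S) \<in> core D"
      using core_add_scale[OF f f, of m "- 1" n] by simp
    have "c * l2norm (\<lambda>S. f m S - f n S) \<le> l2norm (Hshift l1 l2 D t (\<lambda>S. f m S - f n S))"
      unfolding c_def by (rule Hshift_lower[OF d gap[OF d] t])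
    also have "Hshift l1 l2 D t (\<lambda>S. f m S - f n S) = (\<lambda>S. Hshift l1 l2 D t (f m) S - Hshift l1 l2 D t (f n) S)"
      using Hshift_add_scale[OF f f, of l1 l2 t m "- 1" n] by auto
    also have "l2norm \<dots> \<le> l2norm (\<lambda>S. Hshift l1 l2 D t (f m) S - \<phi> S) + l2norm (\<lambda>S. \<phi> S - Hshift l1 l2 D t (f n) S)"
      by (rule l2norm_triangle[OF sh \<phi> sh])
    also have "l2norm (\<lambda>S. Hshift l1 l2 D t (f m) S - \<phi> S) = l2norm (\<lambda>S. \<phi> S - Hshift l1 l2 D t (f m) S)"
      by (rule l2norm_diff_commute)
    finally show ?thesis
      using lim[of m] lim[of n] by linarith
  qed
  have "\<exists>N. \<forall>m\<ge>N. \<forall>n\<ge>N. l2norm (\<lambda>S. f m S - f n S) \<le> e" if "e > 0" for e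
  proof -
    have "c * e / 2 > 0" using c that by simp
    then obtain N where N: "inverse (real (Suc N)) < c * e / 2"
      using reals_Archimedean by blast
    have "l2norm (\<lambda>S. f m S - f n S) \<le> e" if mn: "m \<ge> N" "n \<ge> N" for m n
    proof -
      have "inverse (real (Suc k)) \<le> inverse (real (Suc N))" if "k \<ge> N" for k
        using that by (simp add: le_imp_inverse_le)
      note this[OF mn(1)] this[OF mn(2)]
      then have "c * l2norm (\<lambda>S. f m S - f n S) \<le> c * e"
        using diff[of m n] N by linarith
      then show ?thesis using c by simp
    qed
    then show ?thesis by blast
  qed
  then obtain \<psi> where \<psi>: "square_summable \<psi>" "(\<lambda>n. l2norm (\<lambda>S. f n S - \<psi> S)) \<longlonglongrightarrow> 0"
    "\<And>S. (\<lambda>n. f n S) \<longlonglongrightarrow> \<psi> S"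
    using l2_complete[of f] square_summable_finite(1)[OF core_finite_supp[OF f]] by auto
  have "\<psi> S = 0" if "S \<notin> configs D" for S
  proof -
    have "f n S = 0" for n
      using f[of n] that by (auto simp: core_def)
    then show ?thesis
      using \<psi>(3)[of S] by (simp add: LIMSEQ_const_iff)
  qed
  then have pl: "\<psi> \<in> l2space D"
    using \<psi>(1) by (auto simp: l2space_iff supp_def)
  let ?w = "\<lambda>S. \<phi> S + of_real t * \<psi> S"
  have wl: "?w \<in> l2space D"
    using \<phi> pl by (rule l2space_add_scale)
  have "(\<lambda>n. l2norm (\<lambda>S. Hcore l1 l2 D (f n) S - ?w S)) \<longlonglongrightarrow> 0"
  proof (rule tendsto_sandwich[of "\<lambda>_. 0"])
    have "(\<lambda>n. inverse (real (Suc n)) + t * l2norm (\<lambda>S. f n S - \<psi> S)) \<longlonglongrightarrow> 0 + t * 0"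
      by (intro tendsto_intros \<psi>(2) LIMSEQ_inverse_real_of_nat)
    then show "(\<lambda>n. inverse (real (Suc n)) + t * l2norm (\<lambda>S. f n S - \<psi> S)) \<longlonglongrightarrow> 0"
      by simp
    have "l2norm (\<lambda>S. Hcore l1 l2 D (f n) S - ?w S) \<le> inverse (real (Suc n)) + t * l2norm (\<lambda>S. f n S - \<psi> S)" for n
    proof -
      have "l2norm (\<lambda>S. Hcore l1 l2 D (f n) S - ?w S)
          \<le> l2norm (\<lambda>S. Hshift l1 l2 D t (f n) S - \<phi> S) + cmod (of_real t) * l2norm (\<lambda>S. f n S - \<psi> S)"
        by (rule l2norm_linear(2))
          (use l2space_diff(1)[OF sh \<phi>] l2space_diff(1)[OF core_l2space[OF f] pl] in \<open>auto simp: l2space_iff Hshift_def algebra_simps\<close>)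
      then show ?thesis
        using lim[of n] t(1) l2norm_diff_commute[of "Hshift l1 l2 D t (f n)" \<phi>] by simp
    qed
    then show "\<forall>\<^sub>F n in sequentially. l2norm (\<lambda>S. Hcore l1 l2 D (f n) S - ?w S) \<le> inverse (real (Suc n)) + t * l2norm (\<lambda>S. f n S - \<psi> S)"
      by simp
  qed (auto simp: l2norm_nonneg)
  then show thesis
    using that f \<psi>(2) pl wl by (auto simp: Hgraph_def)
qed

text \<open>Solvability on the closure gives existence. The lower bound gives uniqueness and, with
  constant 1 / c, boundedness of the inverse.\<close>

lemma not_in_spectrum:
  assumes gap: "\<And>f. f \<in> core D \<Longrightarrow> \<delta> * number f \<le> ip f (Hcore l1 l2 D f)" and t: "0 < t" "t < \<delta>"
  shows "complex_of_real t \<notin> op_spectrum (l2space D) (Hgraph l1 l2 D)"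
proof -
  let ?G = "Hgraph l1 l2 D"
  define c where "c = min t (\<delta> - t)"
  have c: "c > 0" using t by (simp add: c_def)
  have lower: "c * l2norm \<psi> \<le> l2norm (\<lambda>S. w S - of_real t * \<psi> S)" if "(\<psi>, w) \<in> ?G" for \<psi> w
    unfolding c_def using gap t that by (rule Hgraph_lower)
  have ex1: "\<exists>!\<psi>. \<exists>w. (\<psi>, w) \<in> ?G \<and> (\<lambda>S. w S - of_real t * \<psi> S) = \<phi>" if \<phi>: "\<phi> \<in> l2space D" for \<phi>
  proof (rule ex_ex1I)
    obtain \<psi> where "(\<psi>, \<lambda>S. \<phi> S + of_real t * \<psi> S) \<in> ?G"
      using Hgraph_solve[OF gap t \<phi>] by blast
    then show "\<exists>\<psi> w. (\<psi>, w) \<in> ?G \<and> (\<lambda>S. w S - of_real t * \<psi> S) = \<phi>"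
      by (intro exI[of _ \<psi>] exI[of _ "\<lambda>S. \<phi> S + of_real t * \<psi> S"]) auto
  next
    fix \<psi> \<psi>'
    assume "\<exists>w. (\<psi>, w) \<in> ?G \<and> (\<lambda>S. w S - of_real t * \<psi> S) = \<phi>"
      and "\<exists>w. (\<psi>', w) \<in> ?G \<and> (\<lambda>S. w S - of_real t * \<psi>' S) = \<phi>"
    then obtain w w' where w: "(\<psi>, w) \<in> ?G" "(\<lambda>S. w S - of_real t * \<psi> S) = \<phi>"
      and w': "(\<psi>', w') \<in> ?G" "(\<lambda>S. w' S - of_real t * \<psi>' S) = \<phi>"
      by blast
    have d: "(\<lambda>S. \<psi> S - \<psi>' S, \<lambda>S. w S - w' S) \<in> ?G"
      using w(1) w'(1) by (rule Hgraph_diff)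
    have "w S - w' S - of_real t * (\<psi> S - \<psi>' S) = 0" for S
      using fun_cong[OF w(2), of S] fun_cong[OF w'(2), of S] by (simp add: algebra_simps)
    then have "c * l2norm (\<lambda>S. \<psi> S - \<psi>' S) \<le> l2norm (\<lambda>S. 0)"
      using lower[OF d] by simp
    then have "l2norm (\<lambda>S. \<psi> S - \<psi>' S) \<le> 0"
      using c by (simp add: l2norm_def mult_le_0_iff)
    moreover have "square_summable (\<lambda>S. \<psi> S - \<psi>' S)"
      using d by (auto simp: Hgraph_def l2space_iff)
    ultimately have "\<psi> S - \<psi>' S = 0" for S
      using l2norm_eq_0D by blast
    then show "\<psi> = \<psi>'" by auto
  qed
  have "\<forall>(\<psi>, w)\<in>?G. l2norm \<psi> \<le> inverse c * l2norm (\<lambda>S. w S - of_real t * \<psi> S)"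
    using lower c by (auto simp: field_simps)
  then have "\<exists>C. \<forall>(\<psi>, w)\<in>?G. l2norm \<psi> \<le> C * l2norm (\<lambda>S. w S - of_real t * \<psi> S)"
    by (rule exI)
  then show ?thesis
    unfolding op_spectrum_def using ex1 by simp
qed

theorem theorem4p1:
  fixes l1 l2 m1 m2 :: real
  assumes "l1 > 0" and "l2 > 0" and "m1\<^sup>2 + m2\<^sup>2 = 1"
    and "(ln l1, ln l2) \<noteq> (- sqrt ((ln l1)\<^sup>2 + (ln l2)\<^sup>2) * m1, - sqrt ((ln l1)\<^sup>2 + (ln l2)\<^sup>2) * m2)"
  shows "spectral_gap (op_spectrum (l2space (half_plane m1 m2)) (Hgraph l1 l2 (half_plane m1 m2))) > 0"
proof -
  let ?D = "half_plane m1 m2"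
  let ?sp = "op_spectrum (l2space ?D) (Hgraph l1 l2 ?D)"
  obtain \<delta> where "\<delta> > 0" and gap: "\<forall>f\<in>core ?D. \<delta> * number f \<le> ip f (Hcore l1 l2 ?D f)"
    using number_le_energy[OF assms] by metis
  \<comment> \<open>The coercivity constant itself serves as a gap: \<open>gap_set\<close> concerns
    only t strictly between 0 and \<delta>.\<close>
  have mem: "\<delta> \<in> gap_set ?sp"
    using \<open>\<delta> > 0\<close> not_in_spectrum[OF bspec[OF gap]] by (simp add: gap_set_def)
  have "0 < ereal \<delta>"
    using \<open>\<delta> > 0\<close> by simp
  also have "\<dots> \<le> Sup (ereal ` gap_set ?sp)"
    using mem by (intro Sup_upper) simp
  also have "\<dots> = spectral_gap ?sp"
    using mem by (auto simp: spectral_gap_def)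
  finally show ?thesis .
qed

end
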